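(* Let $f_\mu\colon X\to X$, $\mu\in\mathbb{R}^\ell$, be the piecewise-affine contractions defined in the context. Then for Lebesgue almost every $\mu\in\mathbb{R}^\ell$, $f_\mu$ is asymptotically periodic on $Z_\mu$.
   Context: $X\subset\mathbb{R}^d$ is a compact convex polytope (the intersection of finitely many closed half-spaces; it need not be full-dimensional), $\mathrm{relint}(X)$ its relative interior (interior relative to its affine hull). Let $\ell\ge1$, $\mathcal{A}=\{-1,1\}^\ell$, and for each $i\in\mathcal{A}$ let $\varphi_i(x)=\Lambda_ix+b_i$ with $\Lambda_i\in GL_d(\mathbb{R})$, $b_i\in\mathbb{R}^d$, $\|\Lambda_i\|<1$ in the operator norm induced by some (fixed) norm on $\mathbb{R}^d$, and $\varphi_i(X)\subset\mathrm{relint}(X)$. Let $v^{(1)},\dots,v^{(\ell)}\in\mathbb{R}^d$ be unit vectors and for $\mu=(\mu_1,\dots,\mu_\ell)\in\mathbb{R}^\ell$ let $H_j(\mu)=\{x:\langle v^{(j)},x\rangle=\mu_j\}$. The label map $\sigma_\mu\colon\mathbb{R}^d\to\mathcal{A}$ is $\sigma_\mu(x)=(s_1(x),\dots,s_\ell(x))$ with $s_j(x)=-1$ if $\langle v^{(j)},x\rangle\le\mu_j$ and $s_j(x)=1$ otherwise. Define $f_\mu(x)=\varphi_{\sigma_\mu(x)}(x)$ for $x\in X$. Its partition is $A_{i,\mu}=\mathrm{relint}(X)\cap\mathrm{relint}(\{x\in X:\sigma_\mu(x)=i\})$, $i\in\mathcal{A}$, and its singular set is $S_\mu=X\setminus\bigcup_iA_{i,\mu}$.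 $Z_\mu$ is the set of $x\in X$ with $f_\mu^n(x)\notin S_\mu$ for all $n\ge0$ (regular points). For a forward invariant $Y$, $f$ is asymptotically periodic on $Y$ if $\bigcup_{x\in Y}\omega(f,x)$ is a union of finitely many periodic orbits, where $\omega(f,x)=\bigcap_{m\ge1}\overline{\bigcup_{n\ge m}\{f^n(x)\}}$. *)

theory Defs
  imports "HOL-Analysis.Analysis"
begin

definition is_norm :: "('a::real_vector \<Rightarrow> real) \<Rightarrow> bool" where
  "is_norm N \<longleftrightarrow> (\<forall>x. 0 \<le> N x) \<and> (\<forall>x. N x = 0 \<longleftrightarrow> x = 0)
     \<and> (\<forall>c x. N (c *\<^sub>R x) = \<bar>c\<bar> * N x) \<and> (\<forall>x y. N (x + y) \<le> N x + N y)"

definition op_norm :: "('a::real_vector \<Rightarrow> real) \<Rightarrow> ('a \<Rightarrow> 'a) \<Rightarrow> real" where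
  "op_norm N L = Sup ((\<lambda>x. N (L x)) ` {x. N x = 1})"

text \<open>Labels: a label i :: 'l \<Rightarrow> bool encodes the sign vector in {-1,1}^l,
  with True standing for 1 and False for -1.\<close>
definition label :: "('l \<Rightarrow> 'a::real_inner) \<Rightarrow> real^'l \<Rightarrow> 'a \<Rightarrow> ('l \<Rightarrow> bool)" where
  "label v \<mu> x = (\<lambda>j. \<not> (v j \<bullet> x \<le> \<mu> $ j))"

definition pwa_map ::
  "(('l \<Rightarrow> bool) \<Rightarrow> 'a \<Rightarrow> 'a) \<Rightarrow> (('l \<Rightarrow> bool) \<Rightarrow> 'a) \<Rightarrow> ('l \<Rightarrow> 'a::real_inner) \<Rightarrow> real^'l \<Rightarrow> 'a \<Rightarrow> 'a" where
  "pwa_map Lam b v \<mu> x = Lam (label v \<mu> x) x + b (label v \<mu> x)"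

definition partition_piece ::
  "'a::euclidean_space set \<Rightarrow> ('l \<Rightarrow> 'a) \<Rightarrow> real^'l \<Rightarrow> ('l \<Rightarrow> bool) \<Rightarrow> 'a set" where
  "partition_piece X v \<mu> i = rel_interior X \<inter> rel_interior {x \<in> X. label v \<mu> x = i}"

definition singular_set :: "'a::euclidean_space set \<Rightarrow> ('l \<Rightarrow> 'a) \<Rightarrow> real^'l \<Rightarrow> 'a set" where
  "singular_set X v \<mu> = X - (\<Union>i. partition_piece X v \<mu> i)"

definition regular_set ::
  "'a::euclidean_space set \<Rightarrow> ('l \<Rightarrow> 'a) \<Rightarrow> real^'l \<Rightarrow> ('a \<Rightarrow> 'a) \<Rightarrow> 'a set" where
  "regular_set X v \<mu> f = {x \<in> X. \<forall>n. (f ^^ n) x \<notin> singular_set X v \<mu>}"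

definition omega_limit :: "('a::topological_space \<Rightarrow> 'a) \<Rightarrow> 'a \<Rightarrow> 'a set" where
  "omega_limit f x = (\<Inter>m\<in>{1..}. closure {(f ^^ n) x | n. n \<ge> m})"

definition orbit :: "('a \<Rightarrow> 'a) \<Rightarrow> 'a \<Rightarrow> 'a set" where
  "orbit f p = {(f ^^ k) p | k. True}"

definition periodic_point :: "('a \<Rightarrow> 'a) \<Rightarrow> 'a \<Rightarrow> bool" where
  "periodic_point f p \<longleftrightarrow> (\<exists>n>0. (f ^^ n) p = p)"

definition asymptotically_periodic :: "('a::topological_space \<Rightarrow> 'a) \<Rightarrow> 'a set \<Rightarrow> bool" where
  "asymptotically_periodic f Y \<longleftrightarrow>
     (\<exists>P. finite P \<and> (\<forall>p\<in>P. periodic_point f p) \<and>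
          (\<Union>x\<in>Y. omega_limit f x) = (\<Union>p\<in>P. orbit f p))"

end

theory Submission
  imports Defs
begin

text \<open>
  If some iterate \<open>f\<^sub>\<mu>\<^sup>n\<close> maps \<open>X\<close> to a positive distance from all the hyperplanes, then \<open>f\<^sub>\<mu>\<close> is locally
  contracting on the closure of \<open>f\<^sub>\<mu>\<^sup>n(X)\<close>, so every orbit is asymptotic to one of finitely many
  periodic orbits. Otherwise, for every \<open>n\<close>, some \<open>\<mu>\<^sub>j\<close> lies within \<open>O(\<lambda>\<^sup>n)\<close> of a value
  \<open>\<langle>v\<^sub>j, \<phi>\<^sub>w(x\<^sub>0)\<rangle>\<close> with \<open>w\<close> a realised itinerary of length \<open>n\<close>; this is a null event near \<open>\<mu>\<close> as soon as the number
  of itineraries of length \<open>n\<close> realised for parameters near \<open>\<mu>\<close> grows more slowly than \<open>\<lambda>\<^sup>-\<^sup>n\<close>.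

  By contraction and compactness, this growth is controlled by the number of times that a single
  branch of an orbit can lie on a hyperplane within \<open>K\<close> steps. For all but finitely many values of
  \<open>\<mu>\<^sub>j\<close>, a pattern of contact times \<open>T\<close> along a word \<open>w\<close> can only occur if there is \<open>u\<close> with
  \<open>\<langle>v\<^sub>j, \<Lambda>\<^bsub>w|t\<^esub> u\<rangle> = 1\<close> for all \<open>t \<in> T\<close>. Because of contraction, a late contact is linearly independent of the early
  ones, and the dimension can only increase \<open>d\<close> times, so \<open>T\<close> has density zero as \<open>K\<close> grows.
\<close>

section \<open>Equivalent norms\<close>

lemma is_norm_equivalent:
  fixes N :: "'a::euclidean_space \<Rightarrow> real"
  assumes "is_norm N"
  obtains c C where "0 < c" "0 < C" "\<And>x. c * norm x \<le> N x" "\<And>x. N x \<le> C * norm x"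
proof -
  have N0: "0 \<le> N x" and Nz: "N x = 0 \<longleftrightarrow> x = 0" and Ns: "N (r *\<^sub>R x) = \<bar>r\<bar> * N x"
    and Nt: "N (x + y) \<le> N x + N y" for x y r
    using assms unfolding is_norm_def by blast+
  define C where "C = (\<Sum>e\<in>Basis. N e) + 1"
  have Cpos: "C > 0" unfolding C_def using sum_nonneg[of Basis N] N0 by force
  have Nsum: "N (sum g A) \<le> (\<Sum>e\<in>A. N (g e))" if "finite A" for g :: "'a \<Rightarrow> 'a" and A
    using that
  proof induction
    case empty then show ?case using Nz[of 0] by simp
  next
    case (insert e A) then show ?case using Nt[of "g e" "sum g A"] by simp
  qed
  have upper: "N x \<le> C * norm x" for x
  proof -
    have "N x = N (\<Sum>e\<in>Basis. (x \<bullet> e) *\<^sub>R e)" by (simp add: euclidean_representation)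
    also have "\<dots> \<le> (\<Sum>e\<in>Basis. \<bar>x \<bullet> e\<bar> * N e)"
      using Nsum[of Basis "\<lambda>e. (x \<bullet> e) *\<^sub>R e"] by (simp add: Ns)
    also have "\<dots> \<le> (\<Sum>e\<in>Basis. norm x * N e)"
      by (intro sum_mono mult_right_mono Basis_le_norm N0)
    also have "\<dots> \<le> C * norm x"
      unfolding C_def by (simp add: sum_distrib_left[symmetric] mult.commute[of _ "norm x"] distrib_left)
    finally show ?thesis .
  qed
  \<comment> \<open>The upper bound makes \<open>N\<close> continuous, so it attains a minimum on
    the compact unit sphere; definiteness makes that minimum positive, and it serves as the lower
    constant.\<close>
  have "C-lipschitz_on UNIV N"
  proof (rule lipschitz_onI)
    fix x y :: 'a
    have "N x \<le> N y + N (x - y)" "N y \<le> N x + N (y - x)"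
      using Nt[of y "x - y"] Nt[of x "y - x"] by simp_all
    then show "dist (N x) (N y) \<le> C * dist x y"
      using upper[of "x - y"] upper[of "y - x"]
      by (simp add: dist_norm norm_minus_commute abs_if)
  qed (use Cpos in simp)
  then have cont: "continuous_on (sphere 0 1) N"
    using lipschitz_on_continuous_on continuous_on_subset by blast
  obtain e :: 'a where e: "e \<in> Basis" using nonempty_Basis by blast
  then have "sphere (0::'a) 1 \<noteq> {}" by (auto intro!: exI[of _ e])
  then obtain z where z: "z \<in> sphere 0 1" "\<And>y. y \<in> sphere 0 1 \<Longrightarrow> N z \<le> N y"
    using continuous_attains_inf[OF _ _ cont] by auto
  have "N z > 0" using z(1) N0[of z] Nz[of z] by force
  moreover have "N z * norm x \<le> N x" for x
  proof (cases "x = 0")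
    case False
    then have "N z \<le> N ((1 / norm x) *\<^sub>R x)" by (intro z) simp
    then show ?thesis using False by (simp add: Ns field_simps)
  qed (simp add: N0)
  ultimately show thesis using that Cpos upper by blast
qed

lemma op_norm_bound:
  fixes N :: "'a::euclidean_space \<Rightarrow> real"
  assumes "is_norm N" "linear L"
  shows "N (L x) \<le> op_norm N L * N x"
proof -
  have N0: "0 \<le> N x" and Nz: "N x = 0 \<longleftrightarrow> x = 0" and Ns: "N (r *\<^sub>R x) = \<bar>r\<bar> * N x" for x r
    using assms(1) unfolding is_norm_def by blast+
  obtain c C where cC: "0 < c" "0 < C" "\<And>x. c * norm x \<le> N x" "\<And>x. N x \<le> C * norm x"
    using is_norm_equivalent[OF assms(1)] by blast
  obtain B where B: "B > 0" "\<And>x. norm (L x) \<le> B * norm x"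
    using linear_bounded_pos[OF assms(2)] by blast
  \<comment> \<open>A real \<open>Sup\<close> bounds its set only when the set is bounded above, so
    boundedness must come from the Euclidean norm first.\<close>
  have "bdd_above ((\<lambda>x. N (L x)) ` {x. N x = 1})"
  proof (rule bdd_aboveI2)
    fix x assume "x \<in> {x. N x = 1}"
    then have "norm x \<le> 1 / c" using cC(3)[of x] cC(1) by (simp add: field_simps)
    then have "B * norm x \<le> B * (1 / c)" using B(1) by (intro mult_left_mono) auto
    then have "norm (L x) \<le> B * (1 / c)" using B(2)[of x] by linarith
    then have "C * norm (L x) \<le> C * (B * (1 / c))" using cC(2) by (intro mult_left_mono) auto
    then show "N (L x) \<le> C * (B * (1 / c))" using cC(4)[of "L x"] by linarith
  qed
  then have unit: "N (L y) \<le> op_norm N L" if "N y = 1" for y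
    unfolding op_norm_def using that by (intro cSUP_upper) auto
  show ?thesis
  proof (cases "x = 0")
    case True
    then show ?thesis using linear_0[OF assms(2)] Nz[of 0] by simp
  next
    case False
    then have pos: "N x > 0" using N0[of x] Nz[of x] by linarith
    have "N (L ((1 / N x) *\<^sub>R x)) \<le> op_norm N L" using pos by (intro unit) (simp add: Ns)
    then show ?thesis using pos by (simp add: Ns linear_scale[OF assms(2)] field_simps)
  qed
qed

section \<open>Omega-limit sets\<close>

lemma omega_limit_iff:
  fixes f :: "'a::metric_space \<Rightarrow> 'a"
  shows "y \<in> omega_limit f x \<longleftrightarrow> (\<forall>e>0. \<forall>m. \<exists>n\<ge>m. dist ((f ^^ n) x) y < e)"
proof
  assume y: "y \<in> omega_limit f x"
  show "\<forall>e>0. \<forall>m. \<exists>n\<ge>m. dist ((f ^^ n) x) y < e"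
  proof (intro allI impI)
    fix e :: real and m assume "e > 0"
    have "y \<in> closure {(f ^^ n) x | n. n \<ge> Suc m}"
      using y unfolding omega_limit_def by (auto dest: bspec[of _ _ "Suc m"])
    then obtain n where "n \<ge> Suc m" "dist ((f ^^ n) x) y < e"
      using \<open>e > 0\<close> unfolding closure_approachable by blast
    then show "\<exists>n\<ge>m. dist ((f ^^ n) x) y < e" by (intro exI[of _ n]) auto
  qed
next
  assume "\<forall>e>0. \<forall>m. \<exists>n\<ge>m. dist ((f ^^ n) x) y < e"
  then show "y \<in> omega_limit f x"
    by (fastforce simp: omega_limit_def closure_approachable)
qed

lemma omega_limit_funpow:
  fixes f :: "'a::metric_space \<Rightarrow> 'a"
  shows "omega_limit f ((f ^^ k) x) = omega_limit f x"
proof (rule set_eqI)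
  fix y
  show "y \<in> omega_limit f ((f ^^ k) x) \<longleftrightarrow> y \<in> omega_limit f x"
  proof
    assume "y \<in> omega_limit f ((f ^^ k) x)"
    then have "\<exists>n\<ge>m. dist ((f ^^ (n + k)) x) y < e" if "e > 0" for e m
      using that by (simp add: omega_limit_iff funpow_add)
    then show "y \<in> omega_limit f x"
      unfolding omega_limit_iff by (meson trans_le_add1)
  next
    assume y: "y \<in> omega_limit f x"
    show "y \<in> omega_limit f ((f ^^ k) x)"
      unfolding omega_limit_iff
    proof (intro allI impI)
      fix e :: real and m assume "e > 0"
      then obtain n where n: "n \<ge> m + k" "dist ((f ^^ n) x) y < e"
        using y unfolding omega_limit_iff by blast
      then have "(f ^^ n) x = (f ^^ (n - k)) ((f ^^ k) x)"
        by (simp flip: comp_apply[of "f ^^ (n - k)" "f ^^ k" x] funpow_add)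
      then show "\<exists>n\<ge>m. dist ((f ^^ n) ((f ^^ k) x)) y < e"
        using n by (intro exI[of _ "n - k"]) auto
    qed
  qed
qed

lemma omega_limit_asymptotic_subset:
  fixes f :: "'a::metric_space \<Rightarrow> 'a"
  assumes "(\<lambda>n. dist ((f ^^ n) x) ((f ^^ n) y)) \<longlonglongrightarrow> 0"
  shows "omega_limit f x \<subseteq> omega_limit f y"
proof
  fix z assume z: "z \<in> omega_limit f x"
  show "z \<in> omega_limit f y"
    unfolding omega_limit_iff
  proof (intro allI impI)
    fix e :: real and m assume "e > 0"
    then have "\<forall>\<^sub>F n in sequentially. dist ((f ^^ n) x) ((f ^^ n) y) < e / 2"
      by (intro order_tendstoD(2)[OF assms]) simp
    then obtain k where k: "\<And>n. n \<ge> k \<Longrightarrow> dist ((f ^^ n) x) ((f ^^ n) y) < e / 2"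
      unfolding eventually_sequentially by blast
    obtain n where n: "n \<ge> max m k" "dist ((f ^^ n) x) z < e / 2"
      using z \<open>e > 0\<close> unfolding omega_limit_iff by (meson half_gt_zero)
    have "dist ((f ^^ n) y) z \<le> dist ((f ^^ n) x) ((f ^^ n) y) + dist ((f ^^ n) x) z"
      by (metis dist_commute dist_triangle)
    then have "dist ((f ^^ n) y) z < e" using k[of n] n by simp
    then show "\<exists>n\<ge>m. dist ((f ^^ n) y) z < e" using n(1) by auto
  qed
qed

lemma omega_limit_asymptotic:
  fixes f :: "'a::metric_space \<Rightarrow> 'a"
  assumes "(\<lambda>n. dist ((f ^^ n) x) ((f ^^ n) y)) \<longlonglongrightarrow> 0"
  shows "omega_limit f x = omega_limit f y"
  using omega_limit_asymptotic_subset[OF assms] omega_limit_asymptotic_subset[of f y x] assms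
  by (simp add: dist_commute subset_antisym)

lemma funpow_fixed_mult: "(f ^^ n) p = p \<Longrightarrow> (f ^^ (k * n)) p = p"
  by (induction k) (simp_all add: funpow_add)

text \<open>The orbit is finite, hence closed, so limits cannot leave it; conversely each of its
  points recurs at arbitrarily late times.\<close>

lemma omega_limit_periodic:
  fixes f :: "'a::metric_space \<Rightarrow> 'a"
  assumes "periodic_point f p"
  shows "omega_limit f p = orbit f p"
proof -
  obtain n where n: "n > 0" "(f ^^ n) p = p" using assms unfolding periodic_point_def by blast
  have red: "(f ^^ k) p = (f ^^ (k mod n)) p" for k
  proof -
    have "(f ^^ k) p = (f ^^ (k mod n)) ((f ^^ (k div n * n)) p)"
      by (simp flip: comp_apply[of "f ^^ (k mod n)" "f ^^ (k div n * n)" p] funpow_add)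
    then show ?thesis using funpow_fixed_mult[OF n(2)] by simp
  qed
  have "orbit f p \<subseteq> (\<lambda>k. (f ^^ k) p) ` {..<n}"
  proof
    fix y assume "y \<in> orbit f p"
    then obtain k where "y = (f ^^ k) p" unfolding orbit_def by blast
    then show "y \<in> (\<lambda>k. (f ^^ k) p) ` {..<n}" using red[of k] n(1) by auto
  qed
  then have fin: "finite (orbit f p)" by (rule finite_subset) simp
  show ?thesis
  proof (rule subset_antisym)
    have "closure {(f ^^ k) p | k. k \<ge> 1} \<subseteq> orbit f p"
      by (rule closure_minimal[OF _ finite_imp_closed[OF fin]]) (auto simp: orbit_def)
    then show "omega_limit f p \<subseteq> orbit f p" unfolding omega_limit_def by auto
    show "orbit f p \<subseteq> omega_limit f p"
    proof
      fix y assume "y \<in> orbit f p"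
      then obtain k where k: "y = (f ^^ k) p" unfolding orbit_def by blast
      show "y \<in> omega_limit f p" unfolding omega_limit_iff
      proof (intro allI impI)
        fix e :: real and m assume "e > 0"
        have "(f ^^ (k + m * n)) p = y" using funpow_fixed_mult[OF n(2)] k by (simp add: funpow_add)
        moreover have "k + m * n \<ge> m" using n(1) by (simp add: trans_le_add2)
        ultimately show "\<exists>i\<ge>m. dist ((f ^^ i) p) y < e" using \<open>e > 0\<close> by (metis dist_self)
      qed
    qed
  qed
qed

section \<open>Contracting families of affine maps\<close>

text \<open>The head of the word acts first, so \<open>take t w\<close> describes the first
  \<open>t\<close> steps of an orbit and concatenation follows time.\<close>

primrec word_lin :: "('i \<Rightarrow> 'a \<Rightarrow> 'a) \<Rightarrow> 'i list \<Rightarrow> 'a \<Rightarrow> 'a" where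
  "word_lin Lam [] x = x"
| "word_lin Lam (i # w) x = word_lin Lam w (Lam i x)"

primrec word_map :: "('i \<Rightarrow> 'a \<Rightarrow> 'a) \<Rightarrow> ('i \<Rightarrow> 'a) \<Rightarrow> 'i list \<Rightarrow> 'a \<Rightarrow> 'a::real_vector" where
  "word_map Lam b [] x = x"
| "word_map Lam b (i # w) x = word_map Lam b w (Lam i x + b i)"

lemma word_lin_append: "word_lin Lam (w @ w') x = word_lin Lam w' (word_lin Lam w x)"
  by (induction w arbitrary: x) simp_all

locale contracting_family =
  fixes N :: "'a::euclidean_space \<Rightarrow> real"
    and Lam :: "'i::finite \<Rightarrow> 'a \<Rightarrow> 'a" and b :: "'i \<Rightarrow> 'a"
    and lam c C :: real
  assumes lin: "\<And>i. linear (Lam i)"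
    and contr: "\<And>i x. N (Lam i x) \<le> lam * N x"
    and lam_pos: "0 < lam" and lam_less: "lam < 1"
    and c_pos: "0 < c" and C_pos: "0 < C"
    and N_lower: "\<And>x. c * norm x \<le> N x" and N_upper: "\<And>x. N x \<le> C * norm x"
begin

lemma N_nonneg: "0 \<le> N x"
  using N_lower[of x] c_pos by (meson mult_nonneg_nonneg norm_ge_zero less_imp_le order_trans)

lemma norm_le_N: "norm x \<le> N x / c"
  using N_lower[of x] c_pos by (simp add: field_simps)

lemma inner_le_N: "\<bar>a \<bullet> x\<bar> \<le> norm a / c * N x"
proof -
  have "\<bar>a \<bullet> x\<bar> \<le> norm a * norm x" by (rule Cauchy_Schwarz_ineq2)
  also have "\<dots> \<le> norm a * (N x / c)" by (intro mult_left_mono norm_le_N) simp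
  finally show ?thesis by simp
qed

lemma linear_word_lin: "linear (word_lin Lam w)"
proof (induction w)
  case Nil
  have "word_lin Lam [] = id" by (auto simp: fun_eq_iff)
  then show ?case by (metis linear_id)
next
  case (Cons i w)
  have "word_lin Lam (i # w) = word_lin Lam w \<circ> Lam i" by (auto simp: fun_eq_iff)
  then show ?case using linear_compose[OF lin[of i] Cons] by (simp only:)
qed

lemma word_lin_contr: "N (word_lin Lam w x) \<le> lam ^ length w * N x"
proof (induction w arbitrary: x)
  case (Cons i w)
  have "N (word_lin Lam (i # w) x) \<le> lam ^ length w * N (Lam i x)" using Cons by simp
  also have "\<dots> \<le> lam ^ length w * (lam * N x)" using lam_pos by (intro mult_left_mono contr) auto
  finally show ?case by (simp add: algebra_simps)
qed simp

lemma word_map_diff: "word_map Lam b w x - word_map Lam b w y = word_lin Lam w (x - y)"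
  by (induction w arbitrary: x y) (simp_all add: linear_diff[OF lin])

lemma word_map_contr: "N (word_map Lam b w x - word_map Lam b w y) \<le> lam ^ length w * N (x - y)"
  unfolding word_map_diff by (rule word_lin_contr)

lemma continuous_on_word_map: "continuous_on S (word_map Lam b w)"
proof -
  have "word_map Lam b w x = word_map Lam b w 0 + word_lin Lam w x" for x
    using word_map_diff[of w x 0] by (metis add.commute diff_add_cancel diff_zero)
  moreover have "continuous_on S (\<lambda>x. word_map Lam b w 0 + word_lin Lam w x)"
    using linear_word_lin by (intro continuous_intros linear_continuous_on)
      (simp add: linear_conv_bounded_linear)
  ultimately show ?thesis by (metis (no_types, lifting) continuous_on_cong)
qed

end

section \<open>Local contractions\<close>

context contracting_family
begin

lemma locally_contracting_funpow:
  assumes inv: "f ` Y \<subseteq> Y"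
    and loc: "\<And>x y. x \<in> Y \<Longrightarrow> y \<in> Y \<Longrightarrow> N (x - y) < r \<Longrightarrow> N (f x - f y) \<le> lam * N (x - y)"
    and xy: "x \<in> Y" "y \<in> Y" "N (x - y) < r"
  shows "N ((f ^^ n) x - (f ^^ n) y) \<le> lam ^ n * N (x - y)"
proof (induction n)
  case (Suc n)
  have Y: "(f ^^ n) z \<in> Y" if "z \<in> Y" for z using inv that by (induction n) auto
  \<comment> \<open>The two orbits never drift further apart than at the start, so
    \<open>loc\<close> stays applicable.\<close>
  have "lam ^ n * N (x - y) \<le> 1 * N (x - y)"
    using lam_pos lam_less by (intro mult_right_mono N_nonneg power_le_one) auto
  then have "N ((f ^^ Suc n) x - (f ^^ Suc n) y) \<le> lam * N ((f ^^ n) x - (f ^^ n) y)"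
    using Suc xy loc[OF Y Y, of x y] by simp
  also have "\<dots> \<le> lam * (lam ^ n * N (x - y))" using Suc lam_pos by (intro mult_left_mono) auto
  finally show ?case by simp
qed simp

lemma lam_power_tendsto: "(\<lambda>n. lam ^ n * a) \<longlonglongrightarrow> 0"
  using tendsto_mult_right[OF LIMSEQ_power_zero[of lam], of a] lam_pos lam_less by simp

lemma locally_contracting_asymptotic:
  assumes inv: "f ` Y \<subseteq> Y"
    and loc: "\<And>x y. x \<in> Y \<Longrightarrow> y \<in> Y \<Longrightarrow> N (x - y) < r \<Longrightarrow> N (f x - f y) \<le> lam * N (x - y)"
    and xy: "x \<in> Y" "y \<in> Y" "N (x - y) < r"
  shows "(\<lambda>n. dist ((f ^^ n) x) ((f ^^ n) y)) \<longlonglongrightarrow> 0"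
proof (rule tendsto_sandwich[OF _ _ tendsto_const lam_power_tendsto[of "N (x - y) / c"]])
  have "dist ((f ^^ n) x) ((f ^^ n) y) \<le> lam ^ n * (N (x - y) / c)" for n
  proof -
    have "dist ((f ^^ n) x) ((f ^^ n) y) \<le> N ((f ^^ n) x - (f ^^ n) y) / c"
      unfolding dist_norm by (rule norm_le_N)
    also have "\<dots> \<le> lam ^ n * N (x - y) / c"
      using c_pos locally_contracting_funpow[OF inv loc xy] by (intro divide_right_mono) auto
    finally show ?thesis by simp
  qed
  then show "\<forall>\<^sub>F n in sequentially. dist ((f ^^ n) x) ((f ^^ n) y) \<le> lam ^ n * (N (x - y) / c)"
    by simp
qed simp

lemma N_less_of_dist: "dist x y < r / C \<Longrightarrow> N (x - y) < r"
  using N_upper[of "x - y"] C_pos by (simp add: dist_norm field_simps)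

lemma locally_contracting_continuous:
  assumes "0 < r"
    and loc: "\<And>x y. x \<in> Y \<Longrightarrow> y \<in> Y \<Longrightarrow> N (x - y) < r \<Longrightarrow> N (f x - f y) \<le> lam * N (x - y)"
  shows "continuous_on Y f"
  unfolding continuous_on_iff
proof (intro ballI allI impI)
  fix x e assume x: "x \<in> Y" and e: "0 < (e::real)"
  show "\<exists>d>0. \<forall>y\<in>Y. dist y x < d \<longrightarrow> dist (f y) (f x) < e"
  proof (intro exI[of _ "min (r / C) (e * c / C)"] conjI ballI impI)
    show "0 < min (r / C) (e * c / C)" using assms(1) e c_pos C_pos by simp
    fix y assume y: "y \<in> Y" "dist y x < min (r / C) (e * c / C)"
    then have N: "N (y - x) < r" "N (y - x) < e * c"
      using N_less_of_dist[of y x] by auto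
    have "lam * N (y - x) \<le> 1 * N (y - x)"
      using lam_less by (intro mult_right_mono N_nonneg) auto
    then have "N (f y - f x) < e * c" using loc[OF y(1) x N(1)] N(2) by simp
    then show "dist (f y) (f x) < e"
      using N_lower[of "f y - f x"] c_pos by (simp add: dist_norm) (smt (verit) mult.commute mult_less_cancel_left_pos)
  qed
qed

text \<open>By compactness the orbit comes within \<open>r\<close> of itself after \<open>p\<close>
  steps. From then on the orbit and its \<open>p\<close>-shift are asymptotic, so any limit
  \<open>q\<close> of the points \<open>y i\<close>, spaced \<open>p\<close> steps apart, is fixed
  by the \<open>p\<close>-th iterate. Some \<open>y i\<close> is within \<open>r\<close> of
  \<open>q\<close>, hence asymptotic to it.\<close>

lemma locally_contracting_omega_limit:
  assumes Y: "compact Y" and inv: "f ` Y \<subseteq> Y" and r: "0 < r"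
    and loc: "\<And>x y. x \<in> Y \<Longrightarrow> y \<in> Y \<Longrightarrow> N (x - y) < r \<Longrightarrow> N (f x - f y) \<le> lam * N (x - y)"
    and x: "x \<in> Y"
  obtains p where "p \<in> Y" "periodic_point f p" "omega_limit f x = orbit f p"
proof -
  have fY: "(f ^^ n) z \<in> Y" if "z \<in> Y" for z n using inv that by (induction n) auto
  have contf: "continuous_on Y (f ^^ n)" for n
  proof (induction n)
    case (Suc n)
    have "continuous_on Y (\<lambda>z. f ((f ^^ n) z))"
      using locally_contracting_continuous[OF r loc]
      by (rule continuous_on_compose2[OF _ Suc]) (auto simp: fY)
    then show ?case by (simp add: comp_def)
  qed simp
  obtain l k where lk: "strict_mono (k::nat \<Rightarrow> nat)" "((\<lambda>n. (f ^^ n) x) \<circ> k) \<longlonglongrightarrow> l"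
    using Y fY[OF x] unfolding compact_def by metis
  then have "Cauchy ((\<lambda>n. (f ^^ n) x) \<circ> k)" by (intro LIMSEQ_imp_Cauchy)
  \<comment> \<open>Euclidean distance below \<open>r / C\<close> is what guarantees
    \<open>N\<close>-distance below \<open>r\<close>.\<close>
  then obtain m where m: "\<And>i j. i \<ge> m \<Longrightarrow> j \<ge> m \<Longrightarrow>
      dist (((\<lambda>n. (f ^^ n) x) \<circ> k) i) (((\<lambda>n. (f ^^ n) x) \<circ> k) j) < r / C"
    using metric_CauchyD[of _ "r / C"] r C_pos by (metis divide_pos_pos)
  define s p where "s = k m" and "p = k (Suc m) - k m"
  have p: "p > 0" using lk(1) by (simp add: p_def strict_mono_def)
  have sp: "k (Suc m) = p + s" using p by (simp add: p_def s_def)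
  have close: "N ((f ^^ (p + s)) x - (f ^^ s) x) < r"
    using m[of "Suc m" m] by (intro N_less_of_dist) (simp add: sp s_def[symmetric])
  define y where "y i = (f ^^ (i * p)) ((f ^^ s) x)" for i
  have yY: "y i \<in> Y" for i by (simp add: y_def fY x)
  have ydist: "(\<lambda>i. dist ((f ^^ p) (y i)) (y i)) \<longlonglongrightarrow> 0"
  proof -
    have "(\<lambda>n. dist ((f ^^ n) ((f ^^ (p + s)) x)) ((f ^^ n) ((f ^^ s) x))) \<longlonglongrightarrow> 0"
      by (rule locally_contracting_asymptotic[OF inv loc]) (use fY x close in auto)
    moreover have "filterlim (\<lambda>i. i * p) sequentially sequentially"
      using p by (intro filterlim_subseq) (auto simp: strict_mono_def)
    ultimately have "(\<lambda>i. dist ((f ^^ (i * p)) ((f ^^ (p + s)) x)) ((f ^^ (i * p)) ((f ^^ s) x))) \<longlonglongrightarrow> 0"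
      by (rule filterlim_compose)
    moreover have "(f ^^ (i * p)) ((f ^^ (p + s)) x) = (f ^^ p) (y i)" for i
      unfolding y_def by (simp flip: funpow_add comp_apply[of "f ^^ a" "f ^^ b" for a b] add: ac_simps)
    ultimately show ?thesis by (simp add: y_def)
  qed
  obtain q h where q: "q \<in> Y" "strict_mono (h::nat \<Rightarrow> nat)" "(y \<circ> h) \<longlonglongrightarrow> q"
    using Y yY unfolding compact_def by metis
  have "(\<lambda>i. (f ^^ p) ((y \<circ> h) i)) \<longlonglongrightarrow> (f ^^ p) q"
    by (rule continuous_on_tendsto_compose[OF contf q(3,1)]) (simp add: yY)
  then have "(\<lambda>i. dist ((f ^^ p) ((y \<circ> h) i)) ((y \<circ> h) i)) \<longlonglongrightarrow> dist ((f ^^ p) q) q"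
    by (intro tendsto_dist q(3))
  moreover have "(\<lambda>i. dist ((f ^^ p) ((y \<circ> h) i)) ((y \<circ> h) i)) \<longlonglongrightarrow> 0"
    using LIMSEQ_subseq_LIMSEQ[OF ydist q(2)] by (simp add: comp_def)
  ultimately have "(f ^^ p) q = q" using LIMSEQ_unique by fastforce
  then have per: "periodic_point f q" using p unfolding periodic_point_def by blast
  obtain i where "dist ((y \<circ> h) i) q < r / C"
    using metric_LIMSEQ_D[OF q(3), of "r / C"] r C_pos by auto
  then have "N (y (h i) - q) < r" by (simp add: N_less_of_dist)
  then have "omega_limit f (y (h i)) = omega_limit f q"
    by (intro omega_limit_asymptotic locally_contracting_asymptotic[OF inv loc] yY q(1))
  then have "omega_limit f x = orbit f q"
    by (simp add: y_def omega_limit_funpow omega_limit_periodic[OF per])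
  then show thesis using that q(1) per by blast
qed

text \<open>Two periodic points within \<open>r\<close> are asymptotic, yet both return
  simultaneously at multiples of a common period, so they coincide. Each ball of a finite cover
  therefore contains at most one.\<close>

lemma locally_contracting_finite_periodic:
  assumes Y: "compact Y" and inv: "f ` Y \<subseteq> Y" and r: "0 < r"
    and loc: "\<And>x y. x \<in> Y \<Longrightarrow> y \<in> Y \<Longrightarrow> N (x - y) < r \<Longrightarrow> N (f x - f y) \<le> lam * N (x - y)"
  shows "finite {p \<in> Y. periodic_point f p}"
proof -
  have eq: "p = q" if pq: "p \<in> Y" "q \<in> Y" "periodic_point f p" "periodic_point f q" "N (p - q) < r" for p q
  proof -
    obtain m n where mn: "m > 0" "(f ^^ m) p = p" "n > 0" "(f ^^ n) q = q"
      using pq unfolding periodic_point_def by blast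
    have fixed: "(f ^^ (i * (m * n))) p = p" "(f ^^ (i * (m * n))) q = q" for i
      using funpow_fixed_mult[OF mn(2), of "i * n"] funpow_fixed_mult[OF mn(4), of "i * m"]
      by (simp_all add: ac_simps)
    have "filterlim (\<lambda>i. i * (m * n)) sequentially sequentially"
      using mn by (intro filterlim_subseq) (auto simp: strict_mono_def)
    from filterlim_compose[OF locally_contracting_asymptotic[OF inv loc pq(1,2,5)] this]
    have "(\<lambda>i::nat. dist p q) \<longlonglongrightarrow> 0" unfolding fixed by simp
    then show ?thesis by (simp add: LIMSEQ_const_iff)
  qed
  have "r / (2 * C) > 0" using r C_pos by simp
  then obtain Z where Z: "finite Z" "Y \<subseteq> (\<Union>z\<in>Z. ball z (r / (2 * C)))"
    using Y unfolding compact_eq_totally_bounded by blast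
  have "finite ({p \<in> Y. periodic_point f p} \<inter> ball z (r / (2 * C)))" (is "finite ?S") for z
  proof (cases "?S = {}")
    case False
    then obtain p where p: "p \<in> ?S" by blast
    have "?S \<subseteq> {p}"
    proof
      fix q assume q: "q \<in> ?S"
      have "dist q p \<le> dist z q + dist z p" by (metis dist_commute dist_triangle)
      also have "\<dots> < r / (2 * C) + r / (2 * C)" using p q by (intro add_strict_mono) auto
      also have "\<dots> = r / C" using C_pos by (simp add: field_simps)
      finally show "q \<in> {p}" using eq[of q p] p q N_less_of_dist by blast
    qed
    then show ?thesis by (rule finite_subset) simp
  qed (simp only: finite.emptyI)
  then have "finite (\<Union>z\<in>Z. {p \<in> Y. periodic_point f p} \<inter> ball z (r / (2 * C)))" using Z(1) by blast
  then show ?thesis by (rule rev_finite_subset) (use Z(2) in auto)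
qed

end

section \<open>Sparsity of contacts\<close>

text \<open>Cut \<open>{..<K}\<close> into blocks of length \<open>L\<close>. Inside a block the
  second alternative of \<open>sep\<close> is impossible, so everything lies within
  \<open>gap\<close> of the least element; the extra 1 accounts for that element itself when
  \<open>gap\<close> is 0.\<close>

lemma sparse_card_le:
  fixes B :: "nat set" and L gap K :: nat
  assumes "B \<subseteq> {..<K}" "L > 0"
    and sep: "\<And>s t. s \<in> B \<Longrightarrow> t \<in> B \<Longrightarrow> s < t \<Longrightarrow> t < s + gap \<or> s + L \<le> t"
  shows "card B \<le> (gap + 1) * (K div L + 1)"
proof -
  have block: "card {t \<in> B. t div L = i} \<le> gap + 1" for i
  proof (cases "{t \<in> B. t div L = i} = {}")
    case False
    define m where "m = (LEAST t. t \<in> B \<and> t div L = i)"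
    have m: "m \<in> B" "m div L = i" and least: "\<And>t. t \<in> B \<Longrightarrow> t div L = i \<Longrightarrow> m \<le> t"
      using False LeastI_ex[of "\<lambda>t. t \<in> B \<and> t div L = i"] Least_le[of "\<lambda>t. t \<in> B \<and> t div L = i"]
      unfolding m_def by auto
    have "{t \<in> B. t div L = i} \<subseteq> {m..<m + gap + 1}"
    proof
      fix t assume t: "t \<in> {t \<in> B. t div L = i}"
      then have "m \<le> t" using least by auto
      have "t < m + L"
      proof (rule ccontr)
        assume "\<not> t < m + L"
        then have "(m + L) div L \<le> t div L" by (intro div_le_mono) simp
        then show False using t m(2) assms(2) by simp
      qed
      then show "t \<in> {m..<m + gap + 1}" using sep[OF m(1), of t] t \<open>m \<le> t\<close> by force
    qed
    then have "card {t \<in> B. t div L = i} \<le> card {m..<m + gap + 1}" by (intro card_mono) auto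
    then show ?thesis by simp
  next
    case True
    then show ?thesis by (simp only: card.empty)
  qed
  have "t div L \<le> K div L" if "t \<in> B" for t
    using assms(1) that by (intro div_le_mono) auto
  then have "B = (\<Union>i\<in>{..K div L}. {t \<in> B. t div L = i})" by auto
  then have "card B = card (\<Union>i\<in>{..K div L}. {t \<in> B. t div L = i})"
    by (rule arg_cong)
  also have "\<dots> \<le> (\<Sum>i\<in>{..K div L}. card {t \<in> B. t div L = i})"
    by (rule card_UN_le) simp
  also have "\<dots> \<le> (\<Sum>i\<in>{..K div L}. gap + 1)" by (intro sum_mono block)
  finally show ?thesis by (simp add: mult.commute)
qed

section \<open>Contact times of a linear orbit with an affine hyperplane\<close>

context contracting_family
begin

text \<open>The value 1 is a normalisation: the difference of two base points is divided by the
  difference of their offsets.\<close>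

definition hits :: "'a \<Rightarrow> 'i list \<Rightarrow> 'a \<Rightarrow> nat set" where
  "hits a w u = {s. s < length w \<and> a \<bullet> word_lin Lam (take s w) u = 1}"

lemma hits_drop:
  assumes "t \<le> length w"
  shows "s \<in> hits a (drop t w) (word_lin Lam (take t w) u) \<longleftrightarrow> t + s \<in> hits a w u"
proof -
  have "word_lin Lam (take s (drop t w)) (word_lin Lam (take t w) u) = word_lin Lam (take (t + s) w) u"
    by (simp add: take_add word_lin_append)
  then show ?thesis using assms by (auto simp: hits_def)
qed

text \<open>All solutions u of the equations given by an early hit pattern agree on the span of the
  corresponding functionals, so one fixed solution decides whether a later functional in that span
  can take the value 1, and contraction forbids this after a bounded time.\<close>
lemma late_hit_independent:
  obtains gap where "\<And>w u s. s \<in> hits a w u \<Longrightarrow> gap \<le> s \<Longrightarrow>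
    adjoint (word_lin Lam (take s w)) a
      \<notin> span ((\<lambda>r. adjoint (word_lin Lam (take r w)) a) ` (hits a w u \<inter> {..<L}))"
proof -
  \<comment> \<open>Through the adjoint, every hit becomes a linear equation on the initial vector
    \<open>u\<close>, and hits at different times can be compared by linear independence.\<close>
  define g where "g p = adjoint (word_lin Lam p) a" for p
  have g: "g p \<bullet> u = a \<bullet> word_lin Lam p u" for p u
    using adjoint_works[OF linear_word_lin, of u p a] by (simp add: g_def inner_commute)
  \<comment> \<open>Only the prefix of length \<open>L\<close> (shorter if the word is) and the
    early hit pattern matter; there are finitely many such pairs, which makes \<open>gap\<close>
    uniform in \<open>w\<close> and \<open>u\<close>.\<close>
  define pats where "pats = {p :: 'i list. set p \<subseteq> UNIV \<and> length p \<le> L} \<times> Pow {..<L}"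
  have "finite pats" unfolding pats_def using finite_lists_length_le[of "UNIV :: 'i set" L] by simp
  have one: "eventually (\<lambda>s. \<forall>w u. take L w = fst pS \<longrightarrow> hits a w u \<inter> {..<L} = snd pS \<longrightarrow>
     s \<in> hits a w u \<longrightarrow> g (take s w) \<notin> span ((\<lambda>r. g (take r w)) ` snd pS)) sequentially" for pS
  proof (cases "\<exists>w0 u0. take L w0 = fst pS \<and> hits a w0 u0 \<inter> {..<L} = snd pS")
    case True
    \<comment> \<open>The reference solution \<open>u0\<close> is fixed by the pair
      \<open>pS\<close>, so the decay estimate below depends on \<open>s\<close> alone and not on
      the size of \<open>u\<close>.\<close>
    then obtain w0 u0 where 0: "take L w0 = fst pS" "hits a w0 u0 \<inter> {..<L} = snd pS" by blast
    have "(\<lambda>s. norm a / c * (lam ^ s * N u0)) \<longlonglongrightarrow> norm a / c * (0 * N u0)"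
      using lam_pos lam_less by (intro tendsto_intros LIMSEQ_power_zero) auto
    then have "eventually (\<lambda>s. norm a / c * (lam ^ s * N u0) < 1) sequentially"
      by (intro order_tendstoD(2)) auto
    then show ?thesis
    proof (rule eventually_mono, intro allI impI notI)
      fix s w u
      assume small: "norm a / c * (lam ^ s * N u0) < 1" and w: "take L w = fst pS"
        and hw: "hits a w u \<inter> {..<L} = snd pS" and s: "s \<in> hits a w u"
        and sp: "g (take s w) \<in> span ((\<lambda>r. g (take r w)) ` snd pS)"
      have "y \<bullet> (u - u0) = 0" if y: "y \<in> (\<lambda>r. g (take r w)) ` snd pS" for y
      proof -
        obtain r where r: "r \<in> snd pS" "y = g (take r w)" using y by blast
        then have "r < L" "r \<in> hits a w u" "r \<in> hits a w0 u0" using hw 0(2) by auto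
        moreover have "take r w = take r w0"
          using w 0(1) \<open>r < L\<close> by (metis min.absorb1 less_imp_le take_take)
        ultimately show ?thesis using r(2) by (simp add: inner_diff_right g hits_def)
      qed
      then have "span ((\<lambda>r. g (take r w)) ` snd pS) \<subseteq> {y. y \<bullet> (u - u0) = 0}"
        by (intro span_minimal subspace_hyperplane2) blast
      then have "g (take s w) \<bullet> (u - u0) = 0" using sp by blast
      then have "a \<bullet> word_lin Lam (take s w) u0 = 1"
        using s by (simp add: inner_diff_right g hits_def)
      moreover have "\<bar>a \<bullet> word_lin Lam (take s w) u0\<bar> \<le> norm a / c * (lam ^ s * N u0)"
      proof -
        have "\<bar>a \<bullet> word_lin Lam (take s w) u0\<bar> \<le> norm a / c * N (word_lin Lam (take s w) u0)"
          by (rule inner_le_N)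
        also have "\<dots> \<le> norm a / c * (lam ^ length (take s w) * N u0)"
          using c_pos by (intro mult_left_mono word_lin_contr) auto
        also have "length (take s w) = s" using s by (simp add: hits_def)
        finally show ?thesis .
      qed
      ultimately show False using small by simp
    qed
  qed simp
  have "eventually (\<lambda>s. \<forall>pS\<in>pats. \<forall>w u. take L w = fst pS \<longrightarrow> hits a w u \<inter> {..<L} = snd pS \<longrightarrow>
     s \<in> hits a w u \<longrightarrow> g (take s w) \<notin> span ((\<lambda>r. g (take r w)) ` snd pS)) sequentially"
    by (intro eventually_ball_finite[OF \<open>finite pats\<close>] ballI one)
  then obtain gap where gap: "\<And>s pS w u. gap \<le> s \<Longrightarrow> pS \<in> pats \<Longrightarrow> take L w = fst pS \<Longrightarrow>
      hits a w u \<inter> {..<L} = snd pS \<Longrightarrow> s \<in> hits a w u \<Longrightarrow>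
      g (take s w) \<notin> span ((\<lambda>r. g (take r w)) ` snd pS)"
    unfolding eventually_sequentially by blast
  show thesis
  proof (rule that[of gap])
    fix w u s assume "s \<in> hits a w u" "gap \<le> s"
    moreover have "(take L w, hits a w u \<inter> {..<L}) \<in> pats" by (auto simp: pats_def)
    ultimately show "adjoint (word_lin Lam (take s w)) a
      \<notin> span ((\<lambda>r. adjoint (word_lin Lam (take r w)) a) ` (hits a w u \<inter> {..<L}))"
      using gap[of s "(take L w, hits a w u \<inter> {..<L})" w u] by (simp add: g_def)
  qed
qed

text \<open>Use \<open>d + 1\<close> nested time scales. A hit is \<open>bad\<close> at scale
  \<open>i\<close> if no other hit follows it with a delay between \<open>gap (L i)\<close> and
  \<open>L (Suc i)\<close>. A hit bad at no scale would be followed by \<open>d + 1\<close> linearly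
  independent functionals in dimension \<open>d\<close>, so the bad sets cover all hits, and each is
  sparse by \<open>sparse_card_le\<close>.\<close>

lemma hits_sparse:
  "eventually (\<lambda>K. \<forall>w u. length w = K \<longrightarrow> q * card (hits a w u) \<le> K) sequentially"
proof -
  define d where "d = DIM('a)"
  have "\<exists>gap. \<forall>w u s. s \<in> hits a w u \<longrightarrow> gap \<le> s \<longrightarrow>
    adjoint (word_lin Lam (take s w)) a
      \<notin> span ((\<lambda>r. adjoint (word_lin Lam (take r w)) a) ` (hits a w u \<inter> {..<L}))" for L
    by (rule late_hit_independent[of a L]) blast
  then obtain gap where gap: "\<And>L w u s. s \<in> hits a w u \<Longrightarrow> gap L \<le> s \<Longrightarrow>
    adjoint (word_lin Lam (take s w)) a
      \<notin> span ((\<lambda>r. adjoint (word_lin Lam (take r w)) a) ` (hits a w u \<inter> {..<L}))"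
    using choice[where Q = "\<lambda>L gap. \<forall>w u s. s \<in> hits a w u \<longrightarrow> gap \<le> s \<longrightarrow>
      adjoint (word_lin Lam (take s w)) a
        \<notin> span ((\<lambda>r. adjoint (word_lin Lam (take r w)) a) ` (hits a w u \<inter> {..<L}))"] by blast
  \<comment> \<open>The increment makes the density of hits bad at scale \<open>i\<close> at most 1
    in \<open>2 * q * (d + 1)\<close>; summed over \<open>d + 1\<close> scales this uses half of the
    allowance \<open>K / q\<close>.\<close>
  define L where "L = rec_nat 0 (\<lambda>i l. l + 2 * q * (d + 1) * (gap l + 1) + 1)"
  have L_Suc: "L (Suc i) = L i + 2 * q * (d + 1) * (gap (L i) + 1) + 1" for i
    by (simp add: L_def)
  define bad where "bad w u i = {t \<in> hits a w u. \<forall>s \<in> hits a w u. s < t + gap (L i) \<or> t + L (Suc i) \<le> s}"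
    for w u i
  have cover: "hits a w u \<subseteq> (\<Union>i\<in>{..d}. bad w u i)" for w u
  proof (rule ccontr)
    assume "\<not> ?thesis"
    then obtain t where t: "t \<in> hits a w u" and nb: "\<And>i. i \<le> d \<Longrightarrow> t \<notin> bad w u i" by auto
    \<comment> \<open>Restarting the orbit at the hit \<open>t\<close> turns delays after
      \<open>t\<close> into hit times, and \<open>t\<close> itself into time 0.\<close>
    define w' u' where "w' = drop t w" and "u' = word_lin Lam (take t w) u"
    define G where "G i = (\<lambda>r. adjoint (word_lin Lam (take r w')) a) ` (hits a w' u' \<inter> {..<L i})" for i
    have tl: "t \<le> length w" using t by (simp add: hits_def)
    have "i \<le> dim (G i)" if "i \<le> Suc d" for i
      using that
    proof (induction i)
      case (Suc i)
      then obtain s where s: "s \<in> hits a w u" "\<not> s < t + gap (L i)" "\<not> t + L (Suc i) \<le> s"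
        using nb[of i] t unfolding bad_def by auto
      define r where "r = s - t"
      have "s = t + r" using s(2) by (simp add: r_def)
      then have r: "r \<in> hits a w' u'" "gap (L i) \<le> r" "r < L (Suc i)"
        using s hits_drop[OF tl, of r] by (auto simp: w'_def u'_def)
      define y where "y = adjoint (word_lin Lam (take r w')) a"
      have "y \<notin> span (G i)" unfolding G_def y_def using r(1,2) by (rule gap)
      then have "dim (insert y (G i)) = dim (G i) + 1" by (simp add: dim_insert)
      moreover have "insert y (G i) \<subseteq> G (Suc i)" using r L_Suc[of i] unfolding G_def y_def by auto
      ultimately show ?case using Suc dim_subset[of "insert y (G i)" "G (Suc i)"] by simp
    qed simp
    then have "Suc d \<le> dim (G (Suc d))" by simp
    then show False using dim_subset_UNIV[of "G (Suc d)"] by (simp add: d_def)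
  qed
  \<comment> \<open>\<open>S\<close> collects the contributions of incomplete blocks; they fit into
    the other half of the allowance once \<open>K\<close> is at least
    \<open>2 * q * S\<close>.\<close>
  define S where "S = (\<Sum>i\<le>d. gap (L i) + 1)"
  show ?thesis
    unfolding eventually_sequentially
  proof (intro exI[of _ "2 * q * S"] allI impI)
    fix K and w :: "'i list" and u assume K: "2 * q * S \<le> K" and w: "length w = K"
    have fin: "finite (hits a w u)" by (rule finite_subset[of _ "{..<K}"]) (auto simp: hits_def w)
    have bad: "card (bad w u i) \<le> (gap (L i) + 1) * (K div L (Suc i) + 1)" for i
    proof (rule sparse_card_le)
      show "bad w u i \<subseteq> {..<K}" using w by (auto simp: bad_def hits_def)
      show "L (Suc i) > 0" by (simp add: L_Suc)
    qed (auto simp: bad_def)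
    have bad': "2 * q * (d + 1) * card (bad w u i) \<le> K + 2 * q * (d + 1) * (gap (L i) + 1)" for i
    proof -
      have "2 * q * (d + 1) * (gap (L i) + 1) * (K div L (Suc i)) \<le> L (Suc i) * (K div L (Suc i))"
        by (intro mult_right_mono) (simp_all add: L_Suc)
      also have "\<dots> \<le> K" by simp
      finally show ?thesis
        using mult_left_mono[OF bad[of i], of "2 * q * (d + 1)"] by (simp add: algebra_simps)
    qed
    have "card (hits a w u) \<le> card (\<Union>i\<in>{..d}. bad w u i)"
      by (intro card_mono cover) (auto intro: finite_subset[OF _ fin] simp: bad_def)
    also have "\<dots> \<le> (\<Sum>i\<le>d. card (bad w u i))" by (rule card_UN_le) simp
    finally have "2 * q * (d + 1) * card (hits a w u) \<le> 2 * q * (d + 1) * (\<Sum>i\<le>d. card (bad w u i))"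
      by (intro mult_left_mono) auto
    also have "\<dots> = (\<Sum>i\<le>d. 2 * q * (d + 1) * card (bad w u i))" by (simp add: sum_distrib_left)
    also have "\<dots> \<le> (\<Sum>i\<le>d. K + 2 * q * (d + 1) * (gap (L i) + 1))" by (intro sum_mono bad')
    also have "\<dots> = (\<Sum>i\<le>d. K) + 2 * q * (d + 1) * S"
      unfolding S_def sum_distrib_left by (rule sum.distrib)
    also have "\<dots> = (d + 1) * K + (d + 1) * (2 * q * S)" by (simp add: algebra_simps)
    also have "\<dots> \<le> (d + 1) * K + (d + 1) * K" by (intro add_left_mono mult_left_mono K) simp
    also have "\<dots> = (2 * (d + 1)) * K" by simp
    also have "2 * q * (d + 1) * card (hits a w u) = (2 * (d + 1)) * (q * card (hits a w u))"
      by (simp only: mult.assoc mult.left_commute)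
    finally have "(2 * (d + 1)) * (q * card (hits a w u)) \<le> (2 * (d + 1)) * K" .
    then show "q * card (hits a w u) \<le> K" by (rule mult_left_le_imp_le) simp
  qed
qed

end

section \<open>Itineraries of piecewise affine contractions\<close>

locale pwa_family = contracting_family N Lam b lam c C
  for N :: "'a::euclidean_space \<Rightarrow> real" and Lam :: "('l::finite \<Rightarrow> bool) \<Rightarrow> 'a \<Rightarrow> 'a"
    and b lam c C +
  fixes X :: "'a set" and v :: "'l \<Rightarrow> 'a"
  assumes compact_X: "compact X"
    and maps_X: "\<And>i x. x \<in> X \<Longrightarrow> Lam i x + b i \<in> X"
begin

abbreviation F :: "real^'l \<Rightarrow> 'a \<Rightarrow> 'a" where
  "F \<mu> \<equiv> pwa_map Lam b v \<mu>"

primrec itinerary :: "nat \<Rightarrow> real^'l \<Rightarrow> 'a \<Rightarrow> ('l \<Rightarrow> bool) list" where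
  "itinerary 0 \<mu> x = []"
| "itinerary (Suc n) \<mu> x = label v \<mu> x # itinerary n \<mu> (F \<mu> x)"

lemma length_itinerary [simp]: "length (itinerary n \<mu> x) = n"
  by (induction n arbitrary: x) simp_all

lemma funpow_F: "(F \<mu> ^^ n) x = word_map Lam b (itinerary n \<mu> x) x"
  by (induction n arbitrary: x) (simp_all add: pwa_map_def funpow_Suc_right del: funpow.simps(2))

lemma itinerary_add:
  "itinerary (m + n) \<mu> x = itinerary m \<mu> x @ itinerary n \<mu> ((F \<mu> ^^ m) x)"
  by (induction m arbitrary: x) (simp_all add: funpow_swap1)

lemma word_map_X: "x \<in> X \<Longrightarrow> word_map Lam b w x \<in> X"
  by (induction w arbitrary: x) (simp_all add: maps_X)

lemma funpow_F_X: "x \<in> X \<Longrightarrow> (F \<mu> ^^ n) x \<in> X"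
  by (simp add: funpow_F word_map_X)

definition admits :: "real^'l \<Rightarrow> 'a \<Rightarrow> ('l \<Rightarrow> bool) \<Rightarrow> bool" where
  "admits \<mu> x i \<longleftrightarrow> (\<forall>j. if i j then \<mu> $ j \<le> v j \<bullet> x else v j \<bullet> x \<le> \<mu> $ j)"

text \<open>Words that are itineraries of \<open>x\<close> when a point on a hyperplane may be assigned to either side.\<close>
definition compat :: "('l \<Rightarrow> bool) list \<Rightarrow> real^'l \<Rightarrow> 'a \<Rightarrow> bool" where
  "compat w \<mu> x \<longleftrightarrow> (\<forall>t<length w. admits \<mu> (word_map Lam b (take t w) x) (w ! t))"

lemma compat_Nil [simp]: "compat [] \<mu> x"
  by (simp add: compat_def)

lemma compat_Cons [simp]:
  "compat (i # w) \<mu> x \<longleftrightarrow> admits \<mu> x i \<and> compat w \<mu> (Lam i x + b i)"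
  by (simp add: compat_def All_less_Suc2)

lemma compat_itinerary: "compat (itinerary n \<mu> x) \<mu> x"
  by (induction n arbitrary: x) (auto simp: admits_def label_def pwa_map_def)

text \<open>Since \<open>admits\<close> uses weak inequalities on both sides, compatibility survives
  limits in the point and the parameter jointly, unlike being the actual itinerary.\<close>

lemma closed_compat: "closed {z. compat w (snd z) (fst z)}"
proof -
  have "closed {z. if (w ! t) j then snd z $ j \<le> v j \<bullet> word_map Lam b (take t w) (fst z)
      else v j \<bullet> word_map Lam b (take t w) (fst z) \<le> snd z $ j}" for t j
  proof -
    have "continuous_on UNIV (\<lambda>z :: 'a \<times> (real^'l). word_map Lam b (take t w) (fst z))"
      by (rule continuous_on_compose2[OF continuous_on_word_map[of UNIV]]) (auto intro: continuous_intros)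
    then show ?thesis
      by (cases "(w ! t) j") (auto intro!: closed_Collect_le continuous_intros)
  qed
  then have "closed (\<Inter>t\<in>{..<length w}. \<Inter>j. {z. if (w ! t) j
      then snd z $ j \<le> v j \<bullet> word_map Lam b (take t w) (fst z)
      else v j \<bullet> word_map Lam b (take t w) (fst z) \<le> snd z $ j})"
    by (intro closed_INT ballI)
  also have "\<dots> = {z. compat w (snd z) (fst z)}"
    by (auto simp: compat_def admits_def)
  finally show ?thesis .
qed

lemma finite_words: "finite {w :: ('l \<Rightarrow> bool) list. length w = n \<and> P w}"
  by (rule finite_subset[OF _ finite_lists_length_eq[of "UNIV :: ('l \<Rightarrow> bool) set" n]]) auto

section \<open>Counting compatible words by their contacts\<close>

definition contacts :: "('l \<Rightarrow> bool) list \<Rightarrow> real^'l \<Rightarrow> 'a \<Rightarrow> nat" where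
  "contacts w \<mu> x = (\<Sum>t<length w. card {j. v j \<bullet> word_map Lam b (take t w) x = \<mu> $ j})"

lemma contacts_Cons:
  "contacts (i # w) \<mu> x = card {j. v j \<bullet> x = \<mu> $ j} + contacts w \<mu> (Lam i x + b i)"
  by (simp add: contacts_def sum.lessThan_Suc_shift del: sum.lessThan_Suc)

lemma card_admits_le: "card {i. admits \<mu> x i} \<le> 2 ^ card {j. v j \<bullet> x = \<mu> $ j}"
proof -
  let ?J = "{j. v j \<bullet> x = \<mu> $ j}"
  have "inj_on (\<lambda>i. {j \<in> ?J. i j}) {i. admits \<mu> x i}"
  proof (rule inj_onI, rule ext)
    fix i i' j assume *: "i \<in> {i. admits \<mu> x i}" "i' \<in> {i. admits \<mu> x i}"
      and eq: "{j \<in> ?J. i j} = {j \<in> ?J. i' j}"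
    show "i j = i' j"
    proof (cases "j \<in> ?J")
      case True then show ?thesis using eq by blast
    next
      case False
      have "(if i j then \<mu> $ j \<le> v j \<bullet> x else v j \<bullet> x \<le> \<mu> $ j)"
        "(if i' j then \<mu> $ j \<le> v j \<bullet> x else v j \<bullet> x \<le> \<mu> $ j)"
        using * by (auto simp: admits_def)
      then show ?thesis using False by (auto split: if_splits)
    qed
  qed
  then have "card {i. admits \<mu> x i} \<le> card (Pow ?J)"
    by (rule card_inj_on_le) auto
  then show ?thesis by (simp add: card_Pow)
qed

text \<open>A Kraft inequality on the tree of compatible words: a node with \<open>h\<close>
  contacts has at most \<open>2 ^ h\<close> children, each weighted by \<open>(1/2) ^ h\<close>.
  Thus contacts need only be bounded along single branches to bound the number of branches.\<close>

lemma compat_Kraft: "(\<Sum>w | length w = n \<and> compat w \<mu> x. (1/2::real) ^ contacts w \<mu> x) \<le> 1"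
proof (induction n arbitrary: x)
  case 0
  have "{w :: ('l \<Rightarrow> bool) list. length w = 0 \<and> compat w \<mu> x} = {[]}" by auto
  then show ?case by (simp add: contacts_def)
next
  case (Suc n)
  define I where "I = {i. admits \<mu> x i}"
  define h where "h = card {j. v j \<bullet> x = \<mu> $ j}"
  define S where "S i = {w. length w = n \<and> compat w \<mu> (Lam i x + b i)}" for i
  have eq: "{w. length w = Suc n \<and> compat w \<mu> x} = (\<lambda>(i, w). i # w) ` Sigma I S"
    by (auto simp: I_def S_def length_Suc_conv image_iff)
  have inj: "inj_on (\<lambda>(i, w). i # w) (Sigma I S)" by (auto simp: inj_on_def)
  have "(\<Sum>w | length w = Suc n \<and> compat w \<mu> x. (1/2::real) ^ contacts w \<mu> x)
    = (\<Sum>(i, w)\<in>Sigma I S. (1/2) ^ contacts (i # w) \<mu> x)"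
    unfolding eq sum.reindex[OF inj] by (simp add: case_prod_beta comp_def)
  also have "\<dots> = (\<Sum>i\<in>I. \<Sum>w\<in>S i. (1/2) ^ contacts (i # w) \<mu> x)"
    by (rule sum.Sigma[symmetric]) (auto simp: S_def finite_words)
  also have "\<dots> = (\<Sum>i\<in>I. (1/2) ^ h * (\<Sum>w\<in>S i. (1/2) ^ contacts w \<mu> (Lam i x + b i)))"
    by (simp add: contacts_Cons h_def power_add sum_distrib_left)
  also have "\<dots> \<le> (\<Sum>i\<in>I. (1/2) ^ h * 1)"
    unfolding S_def by (intro sum_mono mult_left_mono Suc.IH) auto
  also have "\<dots> = real (card I) * (1/2) ^ h" by simp
  also have "\<dots> \<le> real (2 ^ h) * (1/2) ^ h"
    by (intro mult_right_mono) (use card_admits_le[of \<mu> x] in \<open>simp_all add: I_def h_def del: of_nat_power\<close>)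
  also have "\<dots> = 1" by (simp add: power_one_over)
  finally show ?case .
qed

lemma card_compat_le:
  assumes "\<And>w. length w = n \<Longrightarrow> contacts w \<mu> x \<le> H"
  shows "card {w. length w = n \<and> compat w \<mu> x} \<le> 2 ^ H"
proof -
  have "real (card {w. length w = n \<and> compat w \<mu> x}) * (1/2) ^ H
    = (\<Sum>w | length w = n \<and> compat w \<mu> x. (1/2::real) ^ H)" by simp
  also have "\<dots> \<le> (\<Sum>w | length w = n \<and> compat w \<mu> x. (1/2::real) ^ contacts w \<mu> x)"
    using assms by (intro sum_mono power_decreasing) auto
  also have "\<dots> \<le> 1" by (rule compat_Kraft)
  finally have "real (card {w. length w = n \<and> compat w \<mu> x}) \<le> 2 ^ H"
    by (simp add: field_simps power_one_over)
  then show ?thesis by (metis of_nat_le_iff of_nat_numeral of_nat_power)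
qed

lemma contacts_swap:
  "contacts w \<mu> x = (\<Sum>j\<in>UNIV. card {t. t < length w \<and> v j \<bullet> word_map Lam b (take t w) x = \<mu> $ j})"
proof -
  let ?P = "\<lambda>t j. v j \<bullet> word_map Lam b (take t w) x = \<mu> $ j"
  have "contacts w \<mu> x = (\<Sum>t<length w. \<Sum>j\<in>UNIV. of_bool (?P t j))"
    by (simp add: contacts_def Collect_conj_eq)
  also have "\<dots> = (\<Sum>j\<in>UNIV. \<Sum>t<length w. of_bool (?P t j))" by (rule sum.swap)
  also have "\<dots> = (\<Sum>j\<in>UNIV. card {t. t < length w \<and> ?P t j})"
    by (intro sum.cong refl) (simp add: lessThan_def Collect_conj_eq)
  finally show ?thesis .
qed

text \<open>If one pattern of contacts with the j-th hyperplane occurs for two values of its offset, the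
  difference quotient of the two base points solves the homogeneous equations counted by hits.\<close>
lemma generic_contacts:
  assumes K: "\<And>j w u. length w = K \<Longrightarrow> q * card (hits (v j) w u) \<le> K"
  shows "negligible {\<mu>. \<exists>x w j. length w = K \<and>
    K < q * card {t. t < K \<and> v j \<bullet> word_map Lam b (take t w) x = \<mu> $ j}}"
proof -
  define B where "B w j T = {\<mu> :: real^'l. \<exists>x. \<forall>t\<in>T. v j \<bullet> word_map Lam b (take t w) x = \<mu> $ j}" for w j T
  define I where "I = {w :: ('l \<Rightarrow> bool) list. length w = K} \<times> (UNIV :: 'l set) \<times> {T. T \<subseteq> {..<K} \<and> K < q * card T}"
  have neg: "negligible (B w j T)" if T: "length w = K" "T \<subseteq> {..<K}" "K < q * card T" for w j T
  proof -
    \<comment> \<open>The offset is determined by the pattern, which confines \<open>B w j T\<close>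
      to one coordinate hyperplane.\<close>
    have one: "\<mu> $ j = \<nu> $ j" if \<mu>\<nu>: "\<mu> \<in> B w j T" "\<nu> \<in> B w j T" for \<mu> \<nu>
    proof (rule ccontr)
      assume ne: "\<mu> $ j \<noteq> \<nu> $ j"
      obtain x y where xy: "\<And>t. t \<in> T \<Longrightarrow> v j \<bullet> word_map Lam b (take t w) x = \<mu> $ j"
        "\<And>t. t \<in> T \<Longrightarrow> v j \<bullet> word_map Lam b (take t w) y = \<nu> $ j"
        using \<mu>\<nu> unfolding B_def by blast
      define u where "u = (1 / (\<mu> $ j - \<nu> $ j)) *\<^sub>R (x - y)"
      have "v j \<bullet> word_lin Lam (take t w) u = 1" if "t \<in> T" for t
      proof -
        have "v j \<bullet> word_lin Lam (take t w) (x - y) = \<mu> $ j - \<nu> $ j"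
          using xy[OF that] by (simp flip: word_map_diff add: inner_diff_right)
        then show ?thesis using ne by (simp add: u_def linear_scale[OF linear_word_lin])
      qed
      then have "T \<subseteq> hits (v j) w u" using T by (auto simp: hits_def)
      moreover have "finite (hits (v j) w u)" by (simp add: hits_def)
      ultimately have "q * card T \<le> q * card (hits (v j) w u)" by (intro mult_left_mono card_mono) auto
      then show False using K[OF T(1), of j u] T(3) by linarith
    qed
    show ?thesis
    proof (cases "B w j T = {}")
      case False
      then obtain \<nu> where \<nu>: "\<nu> \<in> B w j T" by blast
      have "negligible {\<mu> :: real^'l. \<mu> \<bullet> axis j 1 = \<nu> $ j}"
        by (rule negligible_standard_hyperplane) (simp add: axis_in_Basis_iff)
      then show ?thesis
        by (rule negligible_subset) (use one[OF _ \<nu>] in \<open>auto simp: cart_eq_inner_axis\<close>)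
    qed simp
  qed
  have "finite I" unfolding I_def using finite_words[of K "\<lambda>_. True"] by (intro finite_cartesian_product) simp_all
  then have "negligible (\<Union>(w, j, T)\<in>I. B w j T)"
    by (intro negligible_Union) (auto simp: I_def neg)
  then show ?thesis
  proof (rule negligible_subset, safe)
    fix \<mu> x w j
    assume *: "K = length (w :: ('l \<Rightarrow> bool) list)"
      "length w < q * card {t. t < length w \<and> v j \<bullet> word_map Lam b (take t w) x = \<mu> $ j}"
    let ?T = "{t. t < length w \<and> v j \<bullet> word_map Lam b (take t w) x = \<mu> $ j}"
    have "(w, j, ?T) \<in> I" using * by (auto simp: I_def)
    moreover have "\<mu> \<in> B w j ?T" by (auto simp: B_def)
    ultimately show "\<mu> \<in> (\<Union>(w, j, T)\<in>I. B w j T)" by blast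
  qed
qed

section \<open>Growth of the number of itineraries realised near a parameter\<close>

text \<open>Each \<open>G y\<close> is an open neighbourhood of \<open>(y, \<mu>)\<close> on which
  no word incompatible at \<open>(y, \<mu>)\<close> occurs. A Lebesgue number of this cover gives a
  uniform \<open>e\<close>; the witness \<open>y\<close> need not be \<open>x\<close>.\<close>

lemma local_itineraries_compat:
  obtains e where "e > 0"
    and "\<And>x. x \<in> X \<Longrightarrow> \<exists>y\<in>X. \<forall>x' \<mu>'. dist x' x < e \<longrightarrow> dist \<mu>' \<mu> < e \<longrightarrow> compat (itinerary K \<mu>' x') \<mu> y"
proof -
  define G where "G y = - (\<Union>w\<in>{w. length w = K \<and> \<not> compat w \<mu> y}. {z. compat w (snd z) (fst z)})" for y
  have cpt: "compact ((\<lambda>x. (x, \<mu>)) ` X)"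
    by (intro compact_continuous_image compact_X continuous_intros)
  have "(y, \<mu>) \<in> G y" for y by (simp add: G_def)
  then have cov: "(\<lambda>x. (x, \<mu>)) ` X \<subseteq> \<Union>(G ` X)" by blast
  have opn: "open O'" if "O' \<in> G ` X" for O'
  proof -
    have "open (G y)" for y
      unfolding G_def by (intro open_Compl closed_UN finite_words ballI closed_compat)
    then show ?thesis using that by blast
  qed
  obtain e where e: "e > 0" "\<And>z. z \<in> (\<lambda>x. (x, \<mu>)) ` X \<Longrightarrow> \<exists>O'\<in>G ` X. ball z e \<subseteq> O'"
    using Heine_Borel_lemma[OF cpt cov opn] by metis
  show thesis
  \<comment> \<open>Halving \<open>e\<close> lets the two coordinate distances add up to less than
    \<open>e\<close> in the product metric.\<close>
  proof (rule that[of "e / 2"])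
    fix x assume "x \<in> X"
    then obtain y where y: "y \<in> X" "ball (x, \<mu>) e \<subseteq> G y" using e(2)[of "(x, \<mu>)"] by blast
    have "compat (itinerary K \<mu>' x') \<mu> y" if "dist x' x < e / 2" "dist \<mu>' \<mu> < e / 2" for x' \<mu>'
    proof -
      have "dist (x, \<mu>) (x', \<mu>') \<le> dist x x' + dist \<mu> \<mu>'"
        unfolding dist_Pair_Pair by (rule sqrt_sum_squares_le_sum) auto
      then have "(x', \<mu>') \<in> ball (x, \<mu>) e" using that by (simp add: dist_commute)
      then have "(x', \<mu>') \<in> G y" using y(2) by blast
      then show ?thesis using compat_itinerary[of K \<mu>' x']
        by (auto simp: G_def dest!: spec[of _ "itinerary K \<mu>' x'"])
    qed
    then show "\<exists>y\<in>X. \<forall>x' \<mu>'. dist x' x < e / 2 \<longrightarrow> dist \<mu>' \<mu> < e / 2 \<longrightarrow> compat (itinerary K \<mu>' x') \<mu> y"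
      using y(1) by blast
  qed (use e in simp)
qed

definition words :: "nat \<Rightarrow> 'a set \<Rightarrow> (real^'l) set \<Rightarrow> ('l \<Rightarrow> bool) list set" where
  "words n E U = {itinerary n \<mu> x | \<mu> x. \<mu> \<in> U \<and> x \<in> E}"

lemma finite_words_set: "finite (words n E U)"
  by (rule finite_subset[OF _ finite_words[of n "\<lambda>_. True"]]) (auto simp: words_def)

text \<open>Contraction keeps the images of a small set small, so the local bound on the number of words of
  length K can be iterated.\<close>
lemma card_words_le_power:
  assumes loc: "\<And>E. E \<subseteq> X \<Longrightarrow> (\<And>x y. x \<in> E \<Longrightarrow> y \<in> E \<Longrightarrow> N (x - y) < r) \<Longrightarrow> card (words K E U) \<le> M"
    and E: "E \<subseteq> X" "\<And>x y. x \<in> E \<Longrightarrow> y \<in> E \<Longrightarrow> N (x - y) < r"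
  shows "card (words (m * K) E U) \<le> M ^ m"
  using E
proof (induction m arbitrary: E)
  case 0
  have "words (0 * K) E U \<subseteq> {[]}" by (auto simp: words_def)
  then have "card (words (0 * K) E U) \<le> card {[] :: ('l \<Rightarrow> bool) list}" by (intro card_mono) auto
  then show ?case by simp
next
  case (Suc m)
  define V where "V w = words (m * K) (word_map Lam b w ` E) U" for w
  have step: "card (V w) \<le> M ^ m" for w
    unfolding V_def
  proof (rule Suc.IH)
    show "word_map Lam b w ` E \<subseteq> X" using Suc.prems(1) word_map_X by blast
    fix x y assume "x \<in> word_map Lam b w ` E" "y \<in> word_map Lam b w ` E"
    then obtain x' y' where xy: "x = word_map Lam b w x'" "y = word_map Lam b w y'" "x' \<in> E" "y' \<in> E"
      by blast
    have "N (x - y) \<le> lam ^ length w * N (x' - y')" unfolding xy by (rule word_map_contr)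
    also have "\<dots> \<le> 1 * N (x' - y')"
      using lam_pos lam_less by (intro mult_right_mono N_nonneg power_le_one) auto
    also have "\<dots> < r" using Suc.prems(2) xy by simp
    finally show "N (x - y) < r" .
  qed
  \<comment> \<open>Split after \<open>K\<close> steps: the remaining word starts in the image of
    \<open>E\<close> under the branch of the first block, to which the induction hypothesis
    applies.\<close>
  have "words (Suc m * K) E U \<subseteq> (\<Union>w\<in>words K E U. (@) w ` V w)"
  proof
    fix z assume "z \<in> words (Suc m * K) E U"
    then obtain \<mu> x where z: "z = itinerary (K + m * K) \<mu> x" "\<mu> \<in> U" "x \<in> E" by (auto simp: words_def)
    have "itinerary K \<mu> x \<in> words K E U" using z by (auto simp: words_def)
    moreover have "itinerary (m * K) \<mu> ((F \<mu> ^^ K) x) \<in> V (itinerary K \<mu> x)"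
      using z unfolding V_def words_def funpow_F by blast
    ultimately show "z \<in> (\<Union>w\<in>words K E U. (@) w ` V w)" unfolding z(1) itinerary_add by blast
  qed
  then have "card (words (Suc m * K) E U) \<le> card (\<Union>w\<in>words K E U. (@) w ` V w)"
    by (intro card_mono finite_UN_I finite_words_set finite_imageI) (auto simp: V_def finite_words_set)
  also have "\<dots> \<le> (\<Sum>w\<in>words K E U. card ((@) w ` V w))" by (intro card_UN_le finite_words_set)
  also have "\<dots> \<le> (\<Sum>w\<in>words K E U. M ^ m)"
    by (intro sum_mono order_trans[OF card_image_le step]) (simp add: V_def finite_words_set)
  also have "\<dots> \<le> M * M ^ m" using loc[OF Suc.prems] by simp
  finally show ?case by simp
qed

text \<open>Finitely many balls of \<open>N\<close>-diameter below \<open>r\<close> cover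
  \<open>X\<close>, and \<open>card_words_le_power\<close> applies to each; \<open>A\<close> is the
  number of balls.\<close>

lemma card_words_growth:
  assumes M: "\<And>x. x \<in> X \<Longrightarrow> card {w. length w = K \<and> compat w \<mu> x} \<le> M"
  obtains e A where "e > 0" "\<And>m. card (words (m * K) X (ball \<mu> e)) \<le> A * M ^ m"
proof -
  obtain e where e: "e > 0" "\<And>x. x \<in> X \<Longrightarrow> \<exists>y\<in>X. \<forall>x' \<mu>'. dist x' x < e \<longrightarrow> dist \<mu>' \<mu> < e \<longrightarrow>
      compat (itinerary K \<mu>' x') \<mu> y"
    using local_itineraries_compat[of \<mu> K] by blast
  \<comment> \<open>\<open>N\<close>-distance below \<open>c * e\<close> forces Euclidean distance
    below \<open>e\<close>.\<close>
  define r where "r = c * e"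
  have r: "r > 0" using e(1) c_pos by (simp add: r_def)
  have loc: "card (words K E (ball \<mu> e)) \<le> M"
    if E: "E \<subseteq> X" "\<And>x y. x \<in> E \<Longrightarrow> y \<in> E \<Longrightarrow> N (x - y) < r" for E
  proof (cases "E = {}")
    case True
    then show ?thesis by (simp add: words_def)
  next
    case False
    then obtain x where x: "x \<in> E" by blast
    then obtain y where y: "y \<in> X" "\<And>x' \<mu>'. dist x' x < e \<Longrightarrow> dist \<mu>' \<mu> < e \<Longrightarrow> compat (itinerary K \<mu>' x') \<mu> y"
      using e(2)[of x] E(1) by blast
    have "dist x' x < e" if "x' \<in> E" for x'
    proof -
      have "c * norm (x' - x) < c * e" using N_lower[of "x' - x"] E(2)[OF that x] by (simp add: r_def)
      then show ?thesis using c_pos by (simp add: dist_norm)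
    qed
    then have "words K E (ball \<mu> e) \<subseteq> {w. length w = K \<and> compat w \<mu> y}"
      using y(2) by (auto simp: words_def dist_commute)
    then have "card (words K E (ball \<mu> e)) \<le> card {w. length w = K \<and> compat w \<mu> y}"
      by (intro card_mono finite_words)
    then show ?thesis using M[OF y(1)] by simp
  qed
  have "r / (2 * C) > 0" using r C_pos by simp
  then obtain Z where Z: "finite Z" "X \<subseteq> (\<Union>z\<in>Z. ball z (r / (2 * C)))"
    using compact_X unfolding compact_eq_totally_bounded by blast
  have small: "N (x - y) < r" if "x \<in> X \<inter> ball z (r / (2 * C))" "y \<in> X \<inter> ball z (r / (2 * C))" for x y z
  proof (rule N_less_of_dist)
    have "dist x y \<le> dist z x + dist z y" by (metis dist_commute dist_triangle)
    also have "\<dots> < r / (2 * C) + r / (2 * C)" using that by (intro add_strict_mono) auto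
    also have "\<dots> = r / C" using C_pos by (simp add: field_simps)
    finally show "dist x y < r / C" .
  qed
  have "card (words (m * K) X (ball \<mu> e)) \<le> card Z * M ^ m" for m
  proof -
    have "words (m * K) X (ball \<mu> e) \<subseteq> (\<Union>z\<in>Z. words (m * K) (X \<inter> ball z (r / (2 * C))) (ball \<mu> e))"
    proof
      fix w assume "w \<in> words (m * K) X (ball \<mu> e)"
      then obtain \<mu>' x where w: "w = itinerary (m * K) \<mu>' x" "\<mu>' \<in> ball \<mu> e" "x \<in> X"
        unfolding words_def by blast
      then obtain z where "z \<in> Z" "x \<in> ball z (r / (2 * C))" using Z(2) by blast
      then show "w \<in> (\<Union>z\<in>Z. words (m * K) (X \<inter> ball z (r / (2 * C))) (ball \<mu> e))"
        using w unfolding words_def by blast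
    qed
    then have "card (words (m * K) X (ball \<mu> e))
        \<le> card (\<Union>z\<in>Z. words (m * K) (X \<inter> ball z (r / (2 * C))) (ball \<mu> e))"
      by (intro card_mono finite_UN_I Z finite_words_set)
    also have "\<dots> \<le> (\<Sum>z\<in>Z. card (words (m * K) (X \<inter> ball z (r / (2 * C))) (ball \<mu> e)))"
      by (intro card_UN_le Z)
    also have "\<dots> \<le> (\<Sum>z\<in>Z. M ^ m)"
      by (intro sum_mono card_words_le_power[OF loc]) (use small in auto)
    finally show ?thesis by simp
  qed
  then show thesis using that e(1) by blast
qed

end

section \<open>Parameters whose orbits stay away from the hyperplanes\<close>

lemma measure_slab:
  fixes a :: "real^'l::finite"
  assumes "0 \<le> r"
  shows "measure lebesgue (cbox (\<chi> i. if i = j then s - r else a $ i)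
    (\<chi> i. if i = j then s + r else a $ i + 1)) = 2 * r" (is "measure lebesgue ?S = _")
proof -
  have "?S \<noteq> {}" using assms by (simp add: interval_ne_empty_cart)
  then have "measure lborel ?S = (\<Prod>i\<in>UNIV. (if i = j then s + r else a $ i + 1) - (if i = j then s - r else a $ i))"
    by (simp add: content_cbox_cart)
  also have "\<dots> = (\<Prod>i\<in>UNIV. if i = j then 2 * r else 1)" by (intro prod.cong) auto
  finally show ?thesis by simp
qed

context pwa_family
begin

definition separated :: "real^'l \<Rightarrow> bool" where
  "separated \<mu> \<longleftrightarrow> (\<exists>n \<delta>. \<delta> > 0 \<and> (\<forall>x\<in>X. \<forall>j. \<delta> \<le> \<bar>v j \<bullet> (F \<mu> ^^ n) x - \<mu> $ j\<bar>))"

lemma inner_v_le_N: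
  obtains A where "A > 0" "\<And>j x. \<bar>v j \<bullet> x\<bar> \<le> A * N x"
proof
  show "(\<Sum>j\<in>UNIV. norm (v j) / c) + 1 > 0"
    using c_pos by (intro add_nonneg_pos sum_nonneg) auto
  fix j x
  have "norm (v j) / c \<le> (\<Sum>j\<in>UNIV. norm (v j) / c)"
    using c_pos by (intro member_le_sum) auto
  then have "norm (v j) / c * N x \<le> ((\<Sum>j\<in>UNIV. norm (v j) / c) + 1) * N x"
    by (intro mult_right_mono N_nonneg) simp
  then show "\<bar>v j \<bullet> x\<bar> \<le> ((\<Sum>j\<in>UNIV. norm (v j) / c) + 1) * N x"
    using inner_le_N[of "v j" x] by linarith
qed

lemma separated_asymptotically_periodic:
  assumes "separated \<mu>" "Y \<subseteq> X"
  shows "asymptotically_periodic (F \<mu>) Y"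
proof -
  obtain n \<delta> where \<delta>: "\<delta> > 0" "\<And>x j. x \<in> X \<Longrightarrow> \<delta> \<le> \<bar>v j \<bullet> (F \<mu> ^^ n) x - \<mu> $ j\<bar>"
    using assms(1) unfolding separated_def by blast
  obtain A where A: "A > 0" "\<And>j x. \<bar>v j \<bullet> x\<bar> \<le> A * N x" using inner_v_le_N by blast
  define W where "W = (F \<mu> ^^ n) ` X"
  have WX: "closure W \<subseteq> X"
    by (rule closure_minimal) (auto simp: W_def funpow_F_X compact_X compact_imp_closed)
  have "closed (\<Inter>j. {y. \<delta> \<le> \<bar>v j \<bullet> y - \<mu> $ j\<bar>})"
    by (intro closed_INT ballI closed_Collect_le continuous_intros)
  moreover have "W \<subseteq> (\<Inter>j. {y. \<delta> \<le> \<bar>v j \<bullet> y - \<mu> $ j\<bar>})" using \<delta>(2) by (auto simp: W_def)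
  ultimately have "closure W \<subseteq> (\<Inter>j. {y. \<delta> \<le> \<bar>v j \<bullet> y - \<mu> $ j\<bar>})" by (rule closure_minimal[rotated])
  then have sep: "\<delta> \<le> \<bar>v j \<bullet> y - \<mu> $ j\<bar>" if "y \<in> closure W" for y j using that by blast
  have loc: "N (F \<mu> x - F \<mu> y) \<le> lam * N (x - y)"
    if xy: "x \<in> closure W" "y \<in> closure W" "N (x - y) < \<delta> / A" for x y
  proof -
    \<comment> \<open>Values at distance at least \<open>\<delta>\<close> from
      \<open>\<mu> $ j\<close> on opposite sides of it cannot differ by less than
      \<open>\<delta>\<close>.\<close>
    have "label v \<mu> x = label v \<mu> y"
    proof
      fix j
      have "\<bar>v j \<bullet> x - v j \<bullet> y\<bar> \<le> A * N (x - y)" using A(2)[of j "x - y"] by (simp add: inner_diff_right)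
      also have "\<dots> < \<delta>" using xy(3) A(1) by (simp add: field_simps)
      finally show "label v \<mu> x j = label v \<mu> y j"
        using sep[OF xy(1), of j] sep[OF xy(2), of j] unfolding label_def by linarith
    qed
    then have "F \<mu> x - F \<mu> y = Lam (label v \<mu> x) (x - y)"
      by (simp add: pwa_map_def linear_diff[OF lin])
    then show ?thesis using contr by simp
  qed
  have r: "\<delta> / A > 0" using \<delta>(1) A(1) by simp
  have "F \<mu> ` W \<subseteq> W"
  proof -
    have "F \<mu> ((F \<mu> ^^ n) x) = (F \<mu> ^^ n) (F \<mu> x)" for x by (rule funpow_swap1)
    moreover have "F \<mu> x \<in> X" if "x \<in> X" for x using funpow_F_X[OF that, where n = 1] by simp
    ultimately show ?thesis unfolding W_def by auto
  qed
  \<comment> \<open>Local contraction makes the map continuous on \<open>closure W\<close>, so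
    invariance of \<open>W\<close> passes to its closure.\<close>
  then have inv: "F \<mu> ` closure W \<subseteq> closure W"
    using closure_subset[of W]
    by (intro image_closure_subset locally_contracting_continuous[OF r loc]) auto
  have cW: "compact (closure W)" using compact_X WX closed_closure compact_closure
    by (metis bounded_subset closure_subset compact_eq_bounded_closed subset_trans)
  have ex: "\<exists>p. p \<in> closure W \<and> periodic_point (F \<mu>) p \<and> omega_limit (F \<mu>) x = orbit (F \<mu>) p" if "x \<in> Y" for x
  proof -
    have start: "(F \<mu> ^^ n) x \<in> closure W" using that assms(2) closure_subset[of W] unfolding W_def by blast
    show ?thesis
      by (rule locally_contracting_omega_limit[OF cW inv r loc start]) (auto simp: omega_limit_funpow)
  qed
  then obtain p where p: "\<And>x. x \<in> Y \<Longrightarrow> p x \<in> closure W \<and> periodic_point (F \<mu>) (p x) \<and>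
      omega_limit (F \<mu>) x = orbit (F \<mu>) (p x)"
    by metis
  show ?thesis
    unfolding asymptotically_periodic_def
  proof (intro exI[of _ "p ` Y"] conjI ballI)
    show "finite (p ` Y)"
      by (rule finite_subset[OF _ locally_contracting_finite_periodic[OF cW inv r loc]]) (use p in auto)
  qed (use p in auto)
qed

section \<open>Nullity of the non-separated parameters\<close>

text \<open>For every \<open>m\<close>, a non-separated parameter near \<open>\<mu>0\<close> lies in
  one of at most \<open>A * M ^ m * CARD('l)\<close> slabs whose width is proportional to
  \<open>lam ^ (m * K)\<close>. The total measure tends to 0 because
  \<open>M * lam ^ K < 1\<close>.\<close>

lemma negligible_not_separated_local:
  assumes A: "\<And>m. card (words (m * K) X (ball \<mu>0 e)) \<le> A * M ^ m"
    and small: "real M * lam ^ K < 1" and e: "e > 0"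
  obtains d where "d > 0" "negligible {\<mu> \<in> ball \<mu>0 d. \<not> separated \<mu>}"
proof (cases "X = {}")
  case True
  then have "separated \<mu>" for \<mu> unfolding separated_def by (intro exI[of _ 0] exI[of _ 1]) auto
  then show thesis using that[of 1] by simp
next
  case False
  then obtain x0 where x0: "x0 \<in> X" by blast
  obtain B where B: "B > 0" "\<And>j x. \<bar>v j \<bullet> x\<bar> \<le> B * N x" using inner_v_le_N by blast
  obtain D where D: "\<And>x. x \<in> X \<Longrightarrow> norm (x - x0) \<le> D"
    using compact_X[THEN compact_imp_bounded] unfolding bounded_any_center[of X x0] dist_norm
    by (metis norm_minus_commute)
  have D0: "D \<ge> 0" using D[OF x0] by simp
  \<comment> \<open>\<open>B * (C * D)\<close> pays for replacing the orbit point by the image of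
    the fixed \<open>x0\<close>, and 1 for the distance of the orbit point to the hyperplane, both
    in units of \<open>lam ^ (m * K)\<close>.\<close>
  define R where "R = B * (C * D) + 1"
  have R: "R > 0" unfolding R_def using B C_pos D0 by (intro add_nonneg_pos mult_nonneg_nonneg) auto
  \<comment> \<open>The unit box centred at \<open>\<mu>0\<close> truncates the slabs to finite
    measure; \<open>d\<close> is small enough to stay in this box and within the radius
    \<open>e\<close> of the word count.\<close>
  define a :: "real^'l" where "a = (\<chi> i. \<mu>0 $ i - 1/2)"
  define d where "d = min e (1/2)"
  define slab where "slab m w j = cbox (\<chi> i. if i = j then v j \<bullet> word_map Lam b w x0 - lam ^ (m * K) * R else a $ i)
    (\<chi> i. if i = j then v j \<bullet> word_map Lam b w x0 + lam ^ (m * K) * R else a $ i + 1)" for m w j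
  define T where "T m = (\<Union>(w, j)\<in>words (m * K) X (ball \<mu>0 e) \<times> UNIV. slab m w j)" for m
  have sub: "{\<mu> \<in> ball \<mu>0 d. \<not> separated \<mu>} \<subseteq> T m" for m
  proof
    fix \<mu> assume "\<mu> \<in> {\<mu> \<in> ball \<mu>0 d. \<not> separated \<mu>}"
    then have \<mu>: "dist \<mu>0 \<mu> < d" "\<not> separated \<mu>" by auto
    \<comment> \<open>Separation is refuted at time \<open>m * K\<close> with
      \<open>\<delta>\<close> equal to \<open>lam ^ (m * K)\<close>, the scale of the contraction by
      then.\<close>
    have "lam ^ (m * K) > 0" using lam_pos by simp
    then obtain x j where x: "x \<in> X" and j: "\<bar>v j \<bullet> (F \<mu> ^^ (m * K)) x - \<mu> $ j\<bar> < lam ^ (m * K)"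
      using \<mu>(2) unfolding separated_def by (meson not_le)
    define w where "w = itinerary (m * K) \<mu> x"
    have w: "w \<in> words (m * K) X (ball \<mu>0 e)" using \<mu>(1) x unfolding words_def w_def d_def by auto
    have "\<bar>v j \<bullet> (word_map Lam b w x - word_map Lam b w x0)\<bar> \<le> B * N (word_map Lam b w x - word_map Lam b w x0)"
      by (rule B)
    also have "\<dots> \<le> B * (lam ^ (m * K) * N (x - x0))"
      using word_map_contr[of w x x0] B(1) by (intro mult_left_mono) (auto simp: w_def)
    also have "\<dots> \<le> B * (lam ^ (m * K) * (C * D))"
    proof -
      have "N (x - x0) \<le> C * D"
        using N_upper[of "x - x0"] mult_left_mono[OF D[OF x], of C] C_pos by linarith
      then show ?thesis using B(1) lam_pos by (intro mult_left_mono) auto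
    qed
    finally have "\<bar>v j \<bullet> word_map Lam b w x0 - \<mu> $ j\<bar> \<le> lam ^ (m * K) * R"
      using j unfolding funpow_F w_def[symmetric] by (simp add: R_def inner_diff_right algebra_simps)
    moreover have "a $ i \<le> \<mu> $ i \<and> \<mu> $ i \<le> a $ i + 1" for i
    proof -
      have "\<bar>\<mu>0 $ i - \<mu> $ i\<bar> < 1/2"
        using component_le_norm_cart[of "\<mu>0 - \<mu>" i] \<mu>(1) by (simp add: d_def dist_norm)
      then show ?thesis unfolding a_def vec_lambda_beta by linarith
    qed
    ultimately have "\<mu> \<in> slab m w j" unfolding slab_def mem_box_cart by (auto simp: abs_le_iff)
    then show "\<mu> \<in> T m" using w unfolding T_def by blast
  qed
  have meas: "T m \<in> lmeasurable" for m
    unfolding T_def by (intro fmeasurable.finite_UN finite_cartesian_product finite_words_set)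
      (auto simp: slab_def)
  have slab_measure: "measure lebesgue (slab m w j) = 2 * (lam ^ (m * K) * R)" for m w j
    unfolding slab_def by (rule measure_slab) (use lam_pos R in simp)
  have bound: "measure lebesgue (T m) \<le> real (A * CARD('l)) * (2 * R) * (real M * lam ^ K) ^ m" for m
  proof -
    have "measure lebesgue (T m) \<le> (\<Sum>(w, j)\<in>words (m * K) X (ball \<mu>0 e) \<times> UNIV. measure lebesgue (slab m w j))"
      unfolding T_def
      by (rule order_trans[OF measure_UNION_le]) (auto simp: finite_words_set slab_def case_prod_beta)
    also have "\<dots> = (\<Sum>(w, j::'l)\<in>words (m * K) X (ball \<mu>0 e) \<times> UNIV. 2 * (lam ^ (m * K) * R))"
      by (intro sum.cong refl) (auto simp: slab_measure)
    also have "\<dots> = real (card (words (m * K) X (ball \<mu>0 e)) * CARD('l)) * (2 * (lam ^ (m * K) * R))"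
      by (simp add: case_prod_beta card_cartesian_product)
    also have "\<dots> \<le> real (A * M ^ m * CARD('l)) * (2 * (lam ^ (m * K) * R))"
      using A[of m] lam_pos R by (intro mult_right_mono) (auto simp del: of_nat_mult)
    also have "\<dots> = real (A * CARD('l)) * (2 * R) * (real M * lam ^ K) ^ m"
      by (simp add: power_mult_distrib power_mult mult.commute[of m K])
    finally show ?thesis .
  qed
  have "(\<lambda>m. real (A * CARD('l)) * (2 * R) * (real M * lam ^ K) ^ m) \<longlonglongrightarrow> real (A * CARD('l)) * (2 * R) * 0"
    using small lam_pos by (intro tendsto_intros LIMSEQ_power_zero) auto
  then have lim: "(\<lambda>m. real (A * CARD('l)) * (2 * R) * (real M * lam ^ K) ^ m) \<longlonglongrightarrow> 0" by simp
  have "negligible {\<mu> \<in> ball \<mu>0 d. \<not> separated \<mu>}"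
    unfolding negligible_outer_le
  proof (intro allI impI)
    fix \<epsilon> :: real assume "\<epsilon> > 0"
    then obtain m where "real (A * CARD('l)) * (2 * R) * (real M * lam ^ K) ^ m < \<epsilon>"
      using order_tendstoD(2)[OF lim] unfolding eventually_sequentially by blast
    then have "measure lebesgue (T m) \<le> \<epsilon>" using bound[of m] by linarith
    then show "\<exists>T. {\<mu> \<in> ball \<mu>0 d. \<not> separated \<mu>} \<subseteq> T \<and> T \<in> lmeasurable \<and> measure lebesgue T \<le> \<epsilon>"
      using sub meas by blast
  qed
  moreover have "d > 0" using e by (simp add: d_def)
  ultimately show thesis using that by blast
qed

text \<open>Outside the null set \<open>E\<close>, each hyperplane is met at most
  \<open>K / q\<close> times in \<open>K\<close> steps, so at most \<open>2 ^ H\<close> words of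
  length \<open>K\<close> are compatible at a point. The choice of \<open>q\<close> makes
  contraction win over this growth.\<close>

lemma negligible_not_separated: "negligible {\<mu>. \<not> separated \<mu>}"
proof -
  have "(\<lambda>q. lam ^ q * 2 ^ CARD('l)) \<longlonglongrightarrow> 0" by (rule lam_power_tendsto)
  then obtain q where q: "lam ^ q * 2 ^ CARD('l) < 1"
    using order_tendstoD(2)[of _ 0 sequentially 1] unfolding eventually_sequentially by fastforce
  have q0: "q > 0"
  proof (rule ccontr)
    assume "\<not> q > 0"
    then have "(2::real) ^ CARD('l) < 1" using q by simp
    moreover have "(1::real) \<le> 2 ^ CARD('l)" by (rule one_le_power) simp
    ultimately show False by linarith
  qed
  have "eventually (\<lambda>K. (\<forall>j w u. length w = K \<longrightarrow> q * card (hits (v j) w u) \<le> K) \<and> K > 0) sequentially"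
    by (intro eventually_conj eventually_all_finite hits_sparse eventually_gt_at_top)
  then obtain K where K: "\<And>j w u. length w = K \<Longrightarrow> q * card (hits (v j) w u) \<le> K" "K > 0"
    unfolding eventually_sequentially by blast
  define E where "E = {\<mu>. \<exists>x w j. length w = K \<and>
    K < q * card {t. t < K \<and> v j \<bullet> word_map Lam b (take t w) x = \<mu> $ j}}"
  have E: "negligible E" unfolding E_def by (rule generic_contacts[OF K(1)])
  define H where "H = CARD('l) * K div q"
  \<comment> \<open>Taking the \<open>q\<close>-th power removes the division in \<open>H\<close>
    and leaves the \<open>K\<close>-th power of the quantity made less than 1 by the choice of
    \<open>q\<close>.\<close>
  have MK: "real (2 ^ H) * lam ^ K < 1"
  proof (rule ccontr)
    assume "\<not> ?thesis"
    then have "1 \<le> (2 ^ H * lam ^ K) ^ q" by (intro one_le_power) simp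
    also have "(2 ^ H * lam ^ K) ^ q = 2 ^ (H * q) * (lam ^ q) ^ K"
      by (simp add: power_mult_distrib mult.commute[of K q] flip: power_mult)
    also have "\<dots> \<le> 2 ^ (CARD('l) * K) * (lam ^ q) ^ K"
      using lam_pos by (intro mult_right_mono power_increasing) (auto simp: H_def)
    also have "\<dots> = (lam ^ q * 2 ^ CARD('l)) ^ K" by (simp add: power_mult_distrib power_mult)
    also have "\<dots> < 1" using q lam_pos K(2) by (intro power_less_one_iff[THEN iffD2]) auto
    finally show False by simp
  qed
  have loc: "\<exists>d>0. negligible {\<nu> \<in> ball \<mu> d. \<not> separated \<nu>}" if "\<mu> \<notin> E" for \<mu>
  proof -
    have "card {w. length w = K \<and> compat w \<mu> x} \<le> 2 ^ H" for x
    proof (rule card_compat_le)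
      fix w :: "('l \<Rightarrow> bool) list" assume w: "length w = K"
      have "q * contacts w \<mu> x
        = (\<Sum>j\<in>UNIV. q * card {t. t < K \<and> v j \<bullet> word_map Lam b (take t w) x = \<mu> $ j})"
        by (simp add: contacts_swap sum_distrib_left w)
      also have "\<dots> \<le> (\<Sum>j\<in>(UNIV::'l set). K)"
        using that w unfolding E_def by (intro sum_mono) (auto simp: not_less)
      finally have "q * contacts w \<mu> x \<le> CARD('l) * K" by simp
      then show "contacts w \<mu> x \<le> H"
        using q0 by (simp add: H_def less_eq_div_iff_mult_less_eq mult.commute)
    qed
    then obtain e A where e: "e > 0" and A: "\<And>m. card (words (m * K) X (ball \<mu> e)) \<le> A * (2 ^ H) ^ m"
      using card_words_growth[of K \<mu> "2 ^ H"] by blast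
    show ?thesis by (rule negligible_not_separated_local[OF A MK e]) blast
  qed
  \<comment> \<open>Both the word length bound and the radius are local, so the null sets are
    patched together by local negligibility.\<close>
  have "negligible ({\<mu>. \<not> separated \<mu>} - E)"
  proof (rule locally_negligible_alt[THEN iffD2], rule ballI)
    fix \<mu> assume \<mu>: "\<mu> \<in> {\<mu>. \<not> separated \<mu>} - E"
    then obtain d where d: "d > 0" "negligible {\<nu> \<in> ball \<mu> d. \<not> separated \<nu>}" using loc by blast
    show "\<exists>U. openin (top_of_set ({\<mu>. \<not> separated \<mu>} - E)) U \<and> \<mu> \<in> U \<and> negligible U"
    proof (intro exI[of _ "({\<mu>. \<not> separated \<mu>} - E) \<inter> ball \<mu> d"] conjI)
      show "negligible (({\<mu>. \<not> separated \<mu>} - E) \<inter> ball \<mu> d)"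
        by (rule negligible_subset[OF d(2)]) auto
    qed (use \<mu> d in auto)
  qed
  then have "negligible (({\<mu>. \<not> separated \<mu>} - E) \<union> E)" using E by (rule negligible_Un)
  then show ?thesis by (rule negligible_subset) blast
qed

end

theorem theorem2p12:
  fixes X :: "'a::euclidean_space set"
    and Lam :: "('l::finite \<Rightarrow> bool) \<Rightarrow> 'a \<Rightarrow> 'a"
    and b :: "('l \<Rightarrow> bool) \<Rightarrow> 'a"
    and v :: "'l \<Rightarrow> 'a"
    and N :: "'a \<Rightarrow> real"
  assumes X_polyhedron: "polyhedron X"
    and X_compact: "compact X"
    and Lam_linear: "\<And>i. linear (Lam i)"
    and Lam_invertible: "\<And>i. bij (Lam i)"
    and N_norm: "is_norm N"
    and Lam_contr: "\<And>i. op_norm N (Lam i) < 1"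
    and maps_into: "\<And>i. (\<lambda>x. Lam i x + b i) ` X \<subseteq> rel_interior X"
    and v_unit: "\<And>j. norm (v j) = 1"
  shows "AE \<mu> in lebesgue.
           asymptotically_periodic (pwa_map Lam b v \<mu>)
             (regular_set X v \<mu> (pwa_map Lam b v \<mu>))"
proof -
  obtain c C where cC: "0 < c" "0 < C" "\<And>x. c * norm x \<le> N x" "\<And>x. N x \<le> C * norm x"
    using is_norm_equivalent[OF N_norm] by blast
  have N0: "0 \<le> N x" for x using N_norm unfolding is_norm_def by blast
  \<comment> \<open>A common rate for the finitely many maps; inserting \<open>1/2\<close> makes it
    positive at once and keeps it below 1.\<close>
  define lam where "lam = Max (insert (1/2) (range (\<lambda>i. op_norm N (Lam i))))"
  have lam: "op_norm N (Lam i) \<le> lam" "1/2 \<le> lam" for i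
    unfolding lam_def by (intro Max_ge; simp)+
  have "lam < 1" unfolding lam_def by (subst Max_less_iff) (auto simp: Lam_contr)
  interpret pwa_family N Lam b lam c C X v
  proof (intro pwa_family.intro contracting_family.intro pwa_family_axioms.intro)
    fix i x
    show "N (Lam i x) \<le> lam * N x"
      using op_norm_bound[OF N_norm Lam_linear[of i], of x] mult_right_mono[OF lam(1) N0] by (rule order_trans)
    show "Lam i x + b i \<in> X" if "x \<in> X"
      using maps_into[of i] that rel_interior_subset[of X] by blast
      show "0 < lam" using lam(2) by linarith
  qed (fact cC \<open>lam < 1\<close> X_compact Lam_linear)+
  show ?thesis
  proof (rule AE_I')
    show "{\<mu>. \<not> separated \<mu>} \<in> null_sets lebesgue"
      using negligible_not_separated by (simp add: negligible_iff_null_sets)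
    show "{\<mu> \<in> space lebesgue. \<not> asymptotically_periodic (pwa_map Lam b v \<mu>)
        (regular_set X v \<mu> (pwa_map Lam b v \<mu>))} \<subseteq> {\<mu>. \<not> separated \<mu>}"
      using separated_asymptotically_periodic by (auto simp: regular_set_def)
  qed
qed

end
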